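(* Let $N\in\mathbb{N}$ and let $w\in\mathcal{A}_N^{\mathbb{N}}$ be a periodic infinite word, and let $l\in\mathbb{N}$ be the length of its minimal period. Then for $\mathbf{x}_p\in\mathbf{P}^1(\mathbb{Q}_p)$, the pair $(w,\mathbf{x}_p)$ belongs to $\mathbf{LMad}$ if and only if $\mathbf{x}_p$ coincides with one of the eigenvectors of the matrix $A_{w_l}^T$ (the transpose of $A_{w_l}$).
   Context: Fix a prime $p$; $|\cdot|_p$ is the $p$-adic absolute value on $\mathbb{Q}_p$ (extended to $\overline{\mathbb{Q}}_p$). For $N\in\mathbb{N}$ let $\mathcal{A}_N=\{1,\dots,N\}$. For an infinite word $w=a_1a_2a_3\ldots$ over the positive integers, $\mathrm{T}$ is the left shift $\mathrm{T}w=a_2a_3\ldots$, and $w_l=a_1\ldots a_l$ denotes the prefix of length $l$. For $a\in\mathbb{N}$ put $A_a=\begin{pmatrix}0&1\\1&a\end{pmatrix}$ and for a finite word $u=a_1\ldots a_n$ put $A_u=A_{a_1}\cdots A_{a_n}$ (the identity for the empty word). Points of $\mathbf{P}^1(\mathbb{Q}_p)$ are written as column vectors $\mathbf{q}=(q_1,q_2)^T$ in homogeneous coordinates, and $\mathrm{T}$ is extended to pairs by $\mathrm{T}(w,\mathbf{q})=(\mathrm{T}w, A_{a_1}\mathbf{q})$. For $\epsilon>0$, a point $\mathbf{q}=(q_1,q_2)\in\mathbf{P}^1(\mathbb{Q}_p)$ is in $\mathbf{PBad}_\epsilon$ if for every $(a,b)\in\mathbb{Z}^2\setminus\{(0,0)\}$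 one has $\frac{|aq_1+bq_2|_p}{\max\{|q_1|_p,|q_2|_p\}}\ge \frac{\epsilon}{\max\{a^2,b^2\}}$. The set $\mathbf{LMad}_\epsilon$ consists of the pairs $(w,\mathbf{x}_p)$ ($w$ an infinite word over positive integers, $\mathbf{x}_p\in\mathbf{P}^1(\mathbb{Q}_p)$) such that for every integer $n\ge 0$, $\mathrm{T}^n(w,\mathbf{x}_p)\in\mathcal{A}_N^{\mathbb{N}}\times\mathbf{PBad}_\epsilon$ where $N=\lfloor\epsilon^{-1}\rfloor+1$; and $\mathbf{LMad}=\bigcup_{\epsilon>0}\mathbf{LMad}_\epsilon$. *)

theory Defs
  imports
    "HOL-Analysis.Analysis"
    "HOL-Library.Stream"
    "Berlekamp_Zassenhaus.Finite_Field"
begin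

section \<open>The field of p-adic numbers\<close>

definition rat_padic_abs :: "nat \<Rightarrow> rat \<Rightarrow> real" where
  "rat_padic_abs p x =
    (if x = 0 then 0
     else real p powi (int (multiplicity (int p) (snd (quotient_of x)))
                       - int (multiplicity (int p) (fst (quotient_of x)))))"

definition padic_Cauchy :: "nat \<Rightarrow> (nat \<Rightarrow> rat) \<Rightarrow> bool" where
  "padic_Cauchy p X \<longleftrightarrow> (\<forall>e>0. \<exists>M. \<forall>m\<ge>M. \<forall>n\<ge>M. rat_padic_abs p (X m - X n) < e)"

definition padic_rel :: "nat \<Rightarrow> (nat \<Rightarrow> rat) \<Rightarrow> (nat \<Rightarrow> rat) \<Rightarrow> bool" where
  "padic_rel p X Y \<longleftrightarrow> padic_Cauchy p X \<and> padic_Cauchy p Y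
     \<and> (\<lambda>n. rat_padic_abs p (X n - Y n)) \<longlonglongrightarrow> 0"

lemma rat_padic_abs_0 [simp]: "rat_padic_abs p 0 = 0"
  by (simp add: rat_padic_abs_def)

lemma rat_padic_abs_fraction:
  fixes a b :: int
  assumes p: "prime p" and a: "a \<noteq> 0" and b: "b \<noteq> 0"
  shows "rat_padic_abs p (of_int a / of_int b)
     = real p powi (int (multiplicity (int p) b) - int (multiplicity (int p) a))"
proof -
  let ?x = "of_int a / of_int b :: rat"
  obtain c d where cd: "quotient_of ?x = (c, d)" by fastforce
  have d: "d > 0" using quotient_of_denom_pos[OF cd] .
  have x: "?x = of_int c / of_int d" using quotient_of_div[OF cd] .
  have x0: "?x \<noteq> 0" using a b by simp
  have c: "c \<noteq> 0" using x x0 by auto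
  have "(of_int (a * d) :: rat) = of_int (c * b)"
    using x b d by (simp add: field_simps)
  hence eq: "a * d = c * b" by (simp only: of_int_eq_iff)
  have pp: "prime_elem (int p)" using p by simp
  have "multiplicity (int p) a + multiplicity (int p) d = multiplicity (int p) (a * d)"
    using prime_elem_multiplicity_mult_distrib[OF pp a, of d] d by simp
  also have "\<dots> = multiplicity (int p) c + multiplicity (int p) b"
    using prime_elem_multiplicity_mult_distrib[OF pp c b] eq by simp
  finally have "int (multiplicity (int p) d) - int (multiplicity (int p) c)
      = int (multiplicity (int p) b) - int (multiplicity (int p) a)" by linarith
  thus ?thesis using x0 by (simp add: rat_padic_abs_def cd)
qed

lemma rat_as_fraction:
  obtains a b :: int where "(x :: rat) = of_int a / of_int b" "b > 0"
proof -
  obtain c d where cd: "quotient_of x = (c, d)" by fastforce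
  show ?thesis using that quotient_of_div[OF cd] quotient_of_denom_pos[OF cd] by blast
qed

lemma rat_padic_abs_nonneg [simp]: "rat_padic_abs p x \<ge> 0"
  by (simp add: rat_padic_abs_def)

lemma rat_padic_abs_eq_0_iff: "prime p \<Longrightarrow> rat_padic_abs p x = 0 \<longleftrightarrow> x = 0"
  by (auto simp: rat_padic_abs_def power_int_eq_0_iff dest: prime_gt_0_nat)

lemma rat_padic_abs_1 [simp]: "rat_padic_abs p 1 = 1"
  by (simp add: rat_padic_abs_def)

lemma rat_padic_abs_mult:
  assumes p: "prime p"
  shows "rat_padic_abs p (x * y) = rat_padic_abs p x * rat_padic_abs p y"
proof (cases "x = 0 \<or> y = 0")
  case False
  obtain a b where x: "x = of_int a / of_int b" and b: "b > 0" by (rule rat_as_fraction)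
  obtain c d where y: "y = of_int c / of_int d" and d: "d > 0" by (rule rat_as_fraction)
  have a: "a \<noteq> 0" and c: "c \<noteq> 0" using False x y by auto
  have xy: "x * y = of_int (a * c) / of_int (b * d)" by (simp add: x y)
  have pp: "prime_elem (int p)" using p by simp
  have p0: "real p \<noteq> 0" using prime_gt_0_nat[OF p] by simp
  have "rat_padic_abs p (x * y)
      = real p powi (int (multiplicity (int p) (b * d)) - int (multiplicity (int p) (a * c)))"
    unfolding xy using p a b c d by (intro rat_padic_abs_fraction) auto
  also have "\<dots> = real p powi ((int (multiplicity (int p) b) - int (multiplicity (int p) a))
                + (int (multiplicity (int p) d) - int (multiplicity (int p) c)))"
    using a b c d by (simp add: prime_elem_multiplicity_mult_distrib[OF pp] algebra_simps)
  also have "\<dots> = rat_padic_abs p x * rat_padic_abs p y"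
    unfolding x y using p a b c d p0 by (simp add: rat_padic_abs_fraction power_int_add)
  finally show ?thesis .
qed auto

lemma rat_padic_abs_minus:
  assumes "prime p"
  shows "rat_padic_abs p (- x) = rat_padic_abs p x"
proof -
  have "rat_padic_abs p (- 1) ^ 2 = 1"
    using rat_padic_abs_mult[OF assms, of "- 1" "- 1"] by (simp add: power2_eq_square)
  hence "rat_padic_abs p (- 1) = 1"
    using rat_padic_abs_nonneg[of p "- 1"] by (auto simp: power2_eq_1_iff)
  thus ?thesis using rat_padic_abs_mult[OF assms, of "- 1" x] by simp
qed

lemma rat_padic_abs_inverse:
  assumes "prime p" shows "rat_padic_abs p (inverse x) = inverse (rat_padic_abs p x)"
proof (cases "x = 0")
  case False
  have "rat_padic_abs p x * rat_padic_abs p (inverse x) = 1"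
    using False by (simp flip: rat_padic_abs_mult[OF assms])
  thus ?thesis by (metis inverse_unique)
qed auto

lemma rat_padic_abs_int_le_1:
  assumes p: "prime p" shows "rat_padic_abs p (of_int a) \<le> 1"
proof (cases "a = 0")
  case False
  have "rat_padic_abs p (of_int a) = real p powi (- int (multiplicity (int p) a))"
    using rat_padic_abs_fraction[OF p False, of 1] by simp
  also have "\<dots> \<le> 1" using prime_gt_0_nat[OF p]
    by (simp add: power_int_minus inverse_le_1_iff)
  finally show ?thesis .
qed auto

lemma rat_padic_abs_add:
  assumes p: "prime p"
  shows "rat_padic_abs p (x + y) \<le> max (rat_padic_abs p x) (rat_padic_abs p y)"
proof -
  have 1: "rat_padic_abs p (1 + z) \<le> 1" if z: "rat_padic_abs p z \<le> 1" for z
  proof (cases "z = 0")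
    case False
    obtain a b where q: "quotient_of z = (a, b)" by fastforce
    have zab: "z = of_int a / of_int b" and b: "b > 0" and co: "coprime a b"
      using quotient_of_div[OF q] quotient_of_denom_pos[OF q] quotient_of_coprime[OF q] by auto
    have a: "a \<noteq> 0" using False zab by auto
    have p1: "real p > 1" using prime_gt_1_nat[OF p] by simp
    have "multiplicity (int p) b = 0"
    proof (rule ccontr)
      assume nb: "multiplicity (int p) b \<noteq> 0"
      hence pb: "int p dvd b" by (metis not_dvd_imp_multiplicity_0)
      hence "\<not> int p dvd a" using co p
        by (metis coprime_common_divisor not_prime_unit prime_int_nat_transfer nat_int of_nat_0_le_iff)
      hence na: "multiplicity (int p) a = 0" by (rule not_dvd_imp_multiplicity_0)
      have "rat_padic_abs p z = real p ^ multiplicity (int p) b"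
        using rat_padic_abs_fraction[OF p a, of b] b zab na by simp
      also have "\<dots> > 1" using p1 nb by (simp add: one_less_power)
      finally show False using z by simp
    qed
    hence "rat_padic_abs p (of_int b) = 1"
      using rat_padic_abs_fraction[OF p, of b 1] b by simp
    moreover have "1 + z = of_int (a + b) * inverse (of_int b)"
      using b by (simp add: zab field_simps)
    ultimately have "rat_padic_abs p (1 + z) = rat_padic_abs p (of_int (a + b))"
      by (simp only: rat_padic_abs_mult[OF p] rat_padic_abs_inverse[OF p]) simp
    thus ?thesis using rat_padic_abs_int_le_1[OF p] by metis
  qed auto
  have 2: "rat_padic_abs p (x + y) \<le> rat_padic_abs p x"
    if le: "rat_padic_abs p y \<le> rat_padic_abs p x" for x y
  proof (cases "x = 0")
    case True
    thus ?thesis using le by simp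
  next
    case False
    hence pos: "rat_padic_abs p x > 0"
      using rat_padic_abs_eq_0_iff[OF p] rat_padic_abs_nonneg by (metis less_le)
    have "rat_padic_abs p (y / x) \<le> 1"
      using pos le by (simp add: divide_inverse rat_padic_abs_mult[OF p] rat_padic_abs_inverse[OF p])
         (simp add: field_simps)
    hence "rat_padic_abs p (1 + y / x) \<le> 1" by (rule 1)
    moreover have "x + y = x * (1 + y / x)" using False by (simp add: field_simps)
    ultimately show ?thesis using pos by (simp add: rat_padic_abs_mult[OF p] mult_left_le)
  qed
  show ?thesis
    using 2[of y x] 2[of x y] by (cases "rat_padic_abs p y \<le> rat_padic_abs p x") (auto simp: add.commute)
qed

lemma rat_padic_abs_triangle:
  assumes p: "prime p"
  shows "rat_padic_abs p (x + y) \<le> rat_padic_abs p x + rat_padic_abs p y"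
  using rat_padic_abs_add[OF p, of x y] rat_padic_abs_nonneg[of p x] rat_padic_abs_nonneg[of p y]
  by linarith

lemma rat_padic_abs_diff:
  assumes p: "prime p"
  shows "\<bar>rat_padic_abs p x - rat_padic_abs p y\<bar> \<le> rat_padic_abs p (x - y)"
  using rat_padic_abs_triangle[OF p, of "x - y" y] rat_padic_abs_triangle[OF p, of "y - x" x]
    rat_padic_abs_minus[OF p, of "x - y"] by simp

lemma padic_Cauchy_iff_tendsto:
  "padic_Cauchy p X \<longleftrightarrow>
     ((\<lambda>(m, n). rat_padic_abs p (X m - X n)) \<longlongrightarrow> 0) (sequentially \<times>\<^sub>F sequentially)"
proof -
  have "(\<forall>\<^sub>F (m, n) in sequentially \<times>\<^sub>F sequentially. P m n) \<longleftrightarrow> (\<exists>M. \<forall>m\<ge>M. \<forall>n\<ge>M. P m n)"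
    for P :: "nat \<Rightarrow> nat \<Rightarrow> bool"
    by (simp add: eventually_prod_sequentially) blast
  from this[of "\<lambda>m n. rat_padic_abs p (X m - X n) < e" for e] show ?thesis
    by (simp add: padic_Cauchy_def tendsto_iff dist_real_def case_prod_unfold)
qed

lemma padic_Cauchy_convergent:
  assumes p: "prime p" and X: "padic_Cauchy p X"
  shows "convergent (\<lambda>n. rat_padic_abs p (X n))"
proof -
  have "Cauchy (\<lambda>n. rat_padic_abs p (X n))"
    unfolding Cauchy_def dist_real_def
    using X rat_padic_abs_diff[OF p] unfolding padic_Cauchy_def by (meson le_less_trans)
  thus ?thesis by (rule Cauchy_convergent)
qed

lemma padic_Cauchy_bounded:
  assumes p: "prime p" and X: "padic_Cauchy p X"
  obtains B where "B > 0" "\<And>n. rat_padic_abs p (X n) \<le> B"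
proof -
  have "Bseq (\<lambda>n. rat_padic_abs p (X n))"
    using padic_Cauchy_convergent[OF assms] by (rule convergent_imp_Bseq)
  thus ?thesis using that by (auto simp: Bseq_def)
qed

lemma padic_Cauchy_const [simp]: "padic_Cauchy p (\<lambda>_. c)"
  by (simp add: padic_Cauchy_def)

lemma padic_Cauchy_add:
  assumes p: "prime p" and X: "padic_Cauchy p X" and Y: "padic_Cauchy p Y"
  shows "padic_Cauchy p (\<lambda>n. X n + Y n)"
  unfolding padic_Cauchy_iff_tendsto
proof (rule tendsto_sandwich[OF _ _ tendsto_const])
  let ?F = "sequentially \<times>\<^sub>F sequentially :: (nat \<times> nat) filter"
  show "((\<lambda>z. (case z of (m, n) \<Rightarrow> rat_padic_abs p (X m - X n))
             + (case z of (m, n) \<Rightarrow> rat_padic_abs p (Y m - Y n))) \<longlongrightarrow> 0) ?F"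
    using tendsto_add[OF X[unfolded padic_Cauchy_iff_tendsto] Y[unfolded padic_Cauchy_iff_tendsto]]
    by simp
  show "\<forall>\<^sub>F z in ?F. (case z of (m, n) \<Rightarrow> rat_padic_abs p (X m + Y m - (X n + Y n)))
      \<le> (case z of (m, n) \<Rightarrow> rat_padic_abs p (X m - X n))
             + (case z of (m, n) \<Rightarrow> rat_padic_abs p (Y m - Y n))"
    by (intro always_eventually)
       (auto simp: add_diff_add intro: rat_padic_abs_triangle[OF p])
qed (auto intro!: always_eventually)

lemma padic_Cauchy_minus:
  assumes p: "prime p" and X: "padic_Cauchy p X"
  shows "padic_Cauchy p (\<lambda>n. - X n)"
proof -
  have "rat_padic_abs p (- X m - - X n) = rat_padic_abs p (X m - X n)" for m n
    using rat_padic_abs_minus[OF p, of "X m - X n"] by simp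
  thus ?thesis using X unfolding padic_Cauchy_def by presburger
qed

lemma rat_padic_abs_mult_diff:
  assumes p: "prime p"
  shows "rat_padic_abs p (a * b - c * d)
    \<le> rat_padic_abs p (a - c) * rat_padic_abs p b + rat_padic_abs p c * rat_padic_abs p (b - d)"
proof -
  have "a * b - c * d = (a - c) * b + c * (b - d)" by (simp add: algebra_simps)
  thus ?thesis using rat_padic_abs_triangle[OF p] by (metis rat_padic_abs_mult[OF p])
qed

lemma padic_Cauchy_mult:
  assumes p: "prime p" and X: "padic_Cauchy p X" and Y: "padic_Cauchy p Y"
  shows "padic_Cauchy p (\<lambda>n. X n * Y n)"
proof -
  let ?F = "sequentially \<times>\<^sub>F sequentially :: (nat \<times> nat) filter"
  obtain B where B: "B > 0" "\<And>n. rat_padic_abs p (X n) \<le> B"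
    using padic_Cauchy_bounded[OF p X] by blast
  obtain C where C: "C > 0" "\<And>n. rat_padic_abs p (Y n) \<le> C"
    using padic_Cauchy_bounded[OF p Y] by blast
  show ?thesis
    unfolding padic_Cauchy_iff_tendsto
  proof (rule tendsto_sandwich[OF _ _ tendsto_const])
    show "((\<lambda>z. (case z of (m, n) \<Rightarrow> rat_padic_abs p (X m - X n)) * C
               + B * (case z of (m, n) \<Rightarrow> rat_padic_abs p (Y m - Y n))) \<longlongrightarrow> 0) ?F"
      using tendsto_add[OF tendsto_mult_left_zero[OF X[unfolded padic_Cauchy_iff_tendsto]]
         tendsto_mult_right_zero[OF Y[unfolded padic_Cauchy_iff_tendsto]]]
      by simp
    have "rat_padic_abs p (X m * Y m - X n * Y n)
        \<le> rat_padic_abs p (X m - X n) * C + B * rat_padic_abs p (Y m - Y n)" for m n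
      by (rule order_trans[OF rat_padic_abs_mult_diff[OF p]])
         (intro add_mono mult_left_mono mult_right_mono B C rat_padic_abs_nonneg)
    thus "\<forall>\<^sub>F z in ?F. (case z of (m, n) \<Rightarrow> rat_padic_abs p (X m * Y m - X n * Y n))
        \<le> (case z of (m, n) \<Rightarrow> rat_padic_abs p (X m - X n)) * C
               + B * (case z of (m, n) \<Rightarrow> rat_padic_abs p (Y m - Y n))"
      by (intro always_eventually) auto
  qed (auto intro!: always_eventually)
qed

lemma padic_not_null_bound:
  assumes p: "prime p" and X: "padic_Cauchy p X"
    and nz: "\<not> (\<lambda>n. rat_padic_abs p (X n)) \<longlonglongrightarrow> 0"
  obtains c where "c > 0" "\<forall>\<^sub>F n in sequentially. rat_padic_abs p (X n) > c"
proof -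
  obtain L where L: "(\<lambda>n. rat_padic_abs p (X n)) \<longlonglongrightarrow> L"
    using padic_Cauchy_convergent[OF p X] by (auto simp: convergent_def)
  have "L \<ge> 0" using L by (rule LIMSEQ_le_const) auto
  with nz L have "L > 0" by (cases "L = 0") auto
  hence "L / 2 < L" "L / 2 > 0" by auto
  thus ?thesis using that order_tendstoD(1)[OF L] by blast
qed

lemma rat_padic_abs_inverse_diff:
  assumes p: "prime p" and c: "c > 0"
    and x: "rat_padic_abs p x > c" and y: "rat_padic_abs p y > c"
  shows "rat_padic_abs p (inverse x - inverse y) \<le> rat_padic_abs p (x - y) * (inverse c * inverse c)"
proof -
  have nz: "x \<noteq> 0" "y \<noteq> 0" using c x y by auto
  have "inverse x - inverse y = - ((x - y) * (inverse x * inverse y))"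
    using nz by (simp add: field_simps)
  hence "rat_padic_abs p (inverse x - inverse y)
      = rat_padic_abs p (x - y) * (inverse (rat_padic_abs p x) * inverse (rat_padic_abs p y))"
    by (simp only: rat_padic_abs_minus[OF p] rat_padic_abs_mult[OF p] rat_padic_abs_inverse[OF p])
  also have "\<dots> \<le> rat_padic_abs p (x - y) * (inverse c * inverse c)"
    using c x y by (intro mult_left_mono mult_mono le_imp_inverse_le) auto
  finally show ?thesis .
qed

lemma padic_Cauchy_inverse:
  assumes p: "prime p" and X: "padic_Cauchy p X"
    and nz: "\<not> (\<lambda>n. rat_padic_abs p (X n)) \<longlonglongrightarrow> 0"
  shows "padic_Cauchy p (\<lambda>n. inverse (X n))"
proof -
  let ?F = "sequentially \<times>\<^sub>F sequentially :: (nat \<times> nat) filter"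
  obtain c where c: "c > 0" "\<forall>\<^sub>F n in sequentially. rat_padic_abs p (X n) > c"
    using padic_not_null_bound[OF assms] by blast
  show ?thesis
    unfolding padic_Cauchy_iff_tendsto
  proof (rule tendsto_sandwich[OF _ _ tendsto_const])
    show "((\<lambda>z. (case z of (m, n) \<Rightarrow> rat_padic_abs p (X m - X n)) * (inverse c * inverse c)) \<longlongrightarrow> 0) ?F"
      using tendsto_mult_left_zero[OF X[unfolded padic_Cauchy_iff_tendsto]] .
    show "\<forall>\<^sub>F z in ?F. (case z of (m, n) \<Rightarrow> rat_padic_abs p (inverse (X m) - inverse (X n)))
        \<le> (case z of (m, n) \<Rightarrow> rat_padic_abs p (X m - X n)) * (inverse c * inverse c)"
      using eventually_prodI[OF c(2) c(2)]
      by eventually_elim (auto intro!: rat_padic_abs_inverse_diff[OF p c(1)])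
  qed (auto intro!: always_eventually)
qed

lemma padic_rel_refl: "padic_Cauchy p X \<Longrightarrow> padic_rel p X X"
  by (simp add: padic_rel_def)

lemma padic_part_equivp: assumes p: "prime p" shows "part_equivp (padic_rel p)"
proof (rule part_equivpI)
  show "\<exists>X. padic_rel p X X" by (auto intro!: exI[of _ "\<lambda>_. 0"] simp: padic_rel_def)
  show "symp (padic_rel p)"
    unfolding padic_rel_def by (intro sympI) (metis (no_types, lifting) ext minus_diff_eq rat_padic_abs_minus[OF p])
  show "transp (padic_rel p)"
  proof (rule transpI)
    fix X Y Z assume XY: "padic_rel p X Y" and YZ: "padic_rel p Y Z"
    have "(\<lambda>n. rat_padic_abs p (X n - Z n)) \<longlonglongrightarrow> 0"
    proof (rule tendsto_sandwich[OF _ _ tendsto_const])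
      show "(\<lambda>n. rat_padic_abs p (X n - Y n) + rat_padic_abs p (Y n - Z n)) \<longlonglongrightarrow> 0"
        using XY YZ unfolding padic_rel_def by (auto intro!: tendsto_eq_intros)
      have "rat_padic_abs p (X n - Z n)
          \<le> rat_padic_abs p (X n - Y n) + rat_padic_abs p (Y n - Z n)" for n
        using rat_padic_abs_triangle[OF p, of "X n - Y n" "Y n - Z n"] by simp
      thus "\<forall>\<^sub>F n in sequentially. rat_padic_abs p (X n - Z n)
          \<le> rat_padic_abs p (X n - Y n) + rat_padic_abs p (Y n - Z n)" by simp
    qed auto
    thus "padic_rel p X Z" using XY YZ by (auto simp: padic_rel_def)
  qed
qed

lemma padic_relI:
  assumes p: "prime p" and "padic_Cauchy p X" "padic_Cauchy p Y" "g \<longlonglongrightarrow> 0"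
    and "\<forall>\<^sub>F n in sequentially. rat_padic_abs p (X n - Y n) \<le> g n"
  shows "padic_rel p X Y"
  unfolding padic_rel_def using assms
  by (auto intro: tendsto_sandwich[OF _ _ tendsto_const])

lemma padic_rel_add:
  assumes p: "prime p" and X: "padic_rel p X X'" and Y: "padic_rel p Y Y'"
  shows "padic_rel p (\<lambda>n. X n + Y n) (\<lambda>n. X' n + Y' n)"
proof (rule padic_relI[OF p])
  show "(\<lambda>n. rat_padic_abs p (X n - X' n) + rat_padic_abs p (Y n - Y' n)) \<longlonglongrightarrow> 0"
    using X Y unfolding padic_rel_def by (auto intro!: tendsto_eq_intros)
qed (use X Y in \<open>auto simp: padic_rel_def add_diff_add intro!: padic_Cauchy_add[OF p] always_eventually rat_padic_abs_triangle[OF p]\<close>)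

lemma padic_rel_minus:
  assumes p: "prime p" and X: "padic_rel p X X'"
  shows "padic_rel p (\<lambda>n. - X n) (\<lambda>n. - X' n)"
proof -
  have "rat_padic_abs p (- X n - - X' n) = rat_padic_abs p (X n - X' n)" for n
    using rat_padic_abs_minus[OF p, of "X n - X' n"] by simp
  thus ?thesis using X unfolding padic_rel_def by (auto intro: padic_Cauchy_minus[OF p])
qed

lemma padic_rel_mult:
  assumes p: "prime p" and X: "padic_rel p X X'" and Y: "padic_rel p Y Y'"
  shows "padic_rel p (\<lambda>n. X n * Y n) (\<lambda>n. X' n * Y' n)"
proof -
  have cX: "padic_Cauchy p X'" and cY: "padic_Cauchy p Y"
    using X Y by (auto simp: padic_rel_def)
  obtain B where B: "B > 0" "\<And>n. rat_padic_abs p (X' n) \<le> B"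
    using padic_Cauchy_bounded[OF p cX] by blast
  obtain C where C: "C > 0" "\<And>n. rat_padic_abs p (Y n) \<le> C"
    using padic_Cauchy_bounded[OF p cY] by blast
  show ?thesis
  proof (rule padic_relI[OF p])
    show "(\<lambda>n. rat_padic_abs p (X n - X' n) * C + B * rat_padic_abs p (Y n - Y' n)) \<longlonglongrightarrow> 0"
      using X Y unfolding padic_rel_def by (auto intro!: tendsto_eq_intros)
    have "rat_padic_abs p (X n * Y n - X' n * Y' n)
        \<le> rat_padic_abs p (X n - X' n) * C + B * rat_padic_abs p (Y n - Y' n)" for n
      by (rule order_trans[OF rat_padic_abs_mult_diff[OF p]])
         (intro add_mono mult_left_mono mult_right_mono B C rat_padic_abs_nonneg)
    thus "\<forall>\<^sub>F n in sequentially. rat_padic_abs p (X n * Y n - X' n * Y' n)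
        \<le> rat_padic_abs p (X n - X' n) * C + B * rat_padic_abs p (Y n - Y' n)" by simp
  qed (use X Y in \<open>auto simp: padic_rel_def intro!: padic_Cauchy_mult[OF p]\<close>)
qed

lemma padic_rel_abs_diff:
  assumes p: "prime p" and X: "padic_rel p X X'"
  shows "(\<lambda>n. rat_padic_abs p (X n) - rat_padic_abs p (X' n)) \<longlonglongrightarrow> 0"
proof (rule Lim_null_comparison)
  show "(\<lambda>n. rat_padic_abs p (X n - X' n)) \<longlonglongrightarrow> 0" using X by (simp add: padic_rel_def)
qed (use rat_padic_abs_diff[OF p] in auto)

lemma padic_rel_abs_tendsto_iff:
  assumes p: "prime p" and X: "padic_rel p X X'"
  shows "(\<lambda>n. rat_padic_abs p (X n)) \<longlonglongrightarrow> L \<longleftrightarrow> (\<lambda>n. rat_padic_abs p (X' n)) \<longlonglongrightarrow> L"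
  using tendsto_add[OF padic_rel_abs_diff[OF p X], of "\<lambda>n. rat_padic_abs p (X' n)" L]
    tendsto_diff[OF _ padic_rel_abs_diff[OF p X], of "\<lambda>n. rat_padic_abs p (X n)" L]
  by auto

lemma padic_rel_inverse:
  assumes p: "prime p" and X: "padic_rel p X X'"
    and nz: "\<not> (\<lambda>n. rat_padic_abs p (X n)) \<longlonglongrightarrow> 0"
  shows "padic_rel p (\<lambda>n. inverse (X n)) (\<lambda>n. inverse (X' n))"
proof -
  have nz': "\<not> (\<lambda>n. rat_padic_abs p (X' n)) \<longlonglongrightarrow> 0"
    using nz padic_rel_abs_tendsto_iff[OF p X] by simp
  have cX: "padic_Cauchy p X" and cX': "padic_Cauchy p X'" using X by (auto simp: padic_rel_def)
  obtain c where c: "c > 0" "\<forall>\<^sub>F n in sequentially. rat_padic_abs p (X n) > c"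
    using padic_not_null_bound[OF p cX nz] by blast
  obtain d where d: "d > 0" "\<forall>\<^sub>F n in sequentially. rat_padic_abs p (X' n) > d"
    using padic_not_null_bound[OF p cX' nz'] by blast
  let ?e = "min c d"
  show ?thesis
  proof (rule padic_relI[OF p])
    show "(\<lambda>n. rat_padic_abs p (X n - X' n) * (inverse ?e * inverse ?e)) \<longlonglongrightarrow> 0"
      using X unfolding padic_rel_def by (auto intro!: tendsto_mult_left_zero)
    show "\<forall>\<^sub>F n in sequentially. rat_padic_abs p (inverse (X n) - inverse (X' n))
        \<le> rat_padic_abs p (X n - X' n) * (inverse ?e * inverse ?e)"
      using c(2) d(2)
      by eventually_elim (rule rat_padic_abs_inverse_diff[OF p], use c d in auto)
  qed (use cX cX' nz nz' in \<open>auto intro!: padic_Cauchy_inverse[OF p]\<close>)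
qed

text \<open>The prime \<open>p\<close> is \<open>CARD('p)\<close>; the field \<open>\<rat>\<^sub>p\<close> consists of the \<open>p\<close>-adic Cauchy
  sequences of rationals modulo \<open>p\<close>-adic null sequences.\<close>

typedef ('p::prime_card) padic =
  "{X. padic_Cauchy CARD('p) X} // {(X, Y). padic_rel CARD('p) X Y}"
  morphisms Rep_padic Abs_padic
  by (auto intro!: exI quotientI[of "\<lambda>_. 0"])

definition abs_padic :: "(nat \<Rightarrow> rat) \<Rightarrow> 'p::prime_card padic" where
  "abs_padic X = Abs_padic (Collect (padic_rel CARD('p) X))"

definition rep_padic :: "'p::prime_card padic \<Rightarrow> nat \<Rightarrow> rat" where
  "rep_padic x = (SOME X. X \<in> Rep_padic x)"

definition cr_padic :: "(nat \<Rightarrow> rat) \<Rightarrow> 'p::prime_card padic \<Rightarrow> bool" where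
  "cr_padic = (\<lambda>X y. padic_rel CARD('p) X X \<and> abs_padic X = y)"

lemma padic_rel_refl_iff: "padic_rel p X X \<longleftrightarrow> padic_Cauchy p X"
  by (simp add: padic_rel_def)

lemma padic_quotient_eq:
  "{X. padic_Cauchy p X} // {(X, Y). padic_rel p X Y}
    = {C. \<exists>X. padic_rel p X X \<and> C = Collect (padic_rel p X)}"
  by (auto simp: quotient_def padic_rel_refl_iff Image_def)

lemma Quotient_padic:
  "Quotient (padic_rel CARD('p)) abs_padic rep_padic (cr_padic :: _ \<Rightarrow> 'p::prime_card padic \<Rightarrow> bool)"
proof -
  interpret quot_type "padic_rel CARD('p)" "Abs_padic :: _ \<Rightarrow> 'p padic" Rep_padic
  proof
    show "part_equivp (padic_rel CARD('p))" by (rule padic_part_equivp[OF prime_card])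
    show "\<exists>X. padic_rel CARD('p) X X \<and> Rep_padic y = Collect (padic_rel CARD('p) X)" for y :: "'p padic"
      using Rep_padic[of y] by (simp add: padic_quotient_eq)
    show "Rep_padic (Abs_padic C :: 'p padic) = C"
      if "\<exists>X. padic_rel CARD('p) X X \<and> C = Collect (padic_rel CARD('p) X)" for C
      by (rule Abs_padic_inverse) (use that in \<open>simp add: padic_quotient_eq\<close>)
  qed (auto simp: Rep_padic_inverse Rep_padic_inject)
  have "abs = abs_padic" "rep = rep_padic"
    by (auto simp: fun_eq_iff abs_def abs_padic_def rep_def rep_padic_def)
  hence "Quotient3 (padic_rel CARD('p)) abs_padic (rep_padic :: 'p padic \<Rightarrow> _)"
    using Quotient by simp
  thus ?thesis
    by (rule Quotient3_to_Quotient) (simp add: cr_padic_def)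
qed

setup_lifting Quotient_padic

instantiation padic :: (prime_card) field
begin

lift_definition zero_padic :: "'a padic" is "\<lambda>_. 0" by (simp add: padic_rel_refl)
lift_definition one_padic :: "'a padic" is "\<lambda>_. 1" by (simp add: padic_rel_refl)
lift_definition plus_padic :: "'a padic \<Rightarrow> 'a padic \<Rightarrow> 'a padic" is "\<lambda>X Y n. X n + Y n"
  by (rule padic_rel_add[OF prime_card])
lift_definition uminus_padic :: "'a padic \<Rightarrow> 'a padic" is "\<lambda>X n. - X n"
  by (rule padic_rel_minus[OF prime_card])
lift_definition times_padic :: "'a padic \<Rightarrow> 'a padic \<Rightarrow> 'a padic" is "\<lambda>X Y n. X n * Y n"
  by (rule padic_rel_mult[OF prime_card])
lift_definition inverse_padic :: "'a padic \<Rightarrow> 'a padic" is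
  "\<lambda>X. if (\<lambda>n. rat_padic_abs CARD('a) (X n)) \<longlonglongrightarrow> 0 then (\<lambda>_. 0) else (\<lambda>n. inverse (X n))"
  using padic_rel_abs_tendsto_iff[OF prime_card[where 'a='a], where L=0]
    padic_rel_inverse[OF prime_card[where 'a='a]]
  by (simp add: padic_rel_refl)

definition minus_padic :: "'a padic \<Rightarrow> 'a padic \<Rightarrow> 'a padic" where "minus_padic x y = x + - y"
definition divide_padic :: "'a padic \<Rightarrow> 'a padic \<Rightarrow> 'a padic" where "divide_padic x y = x * inverse y"

instance
proof
  fix a b c :: "'a padic"
  note prime = prime_card[where 'a='a]
  note cl = padic_rel_def padic_Cauchy_add[OF prime] padic_Cauchy_mult[OF prime] padic_Cauchy_minus[OF prime]
  show "a + b + c = a + (b + c)" by transfer (auto simp: cl algebra_simps)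
  show "a + b = b + a" by transfer (auto simp: cl algebra_simps)
  show "0 + a = a" by transfer (auto simp: cl)
  show "- a + a = 0" by transfer (auto simp: cl)
  show "a - b = a + - b" by (simp add: minus_padic_def)
  show "a * b * c = a * (b * c)" by transfer (auto simp: cl algebra_simps)
  show "a * b = b * a" by transfer (auto simp: cl algebra_simps)
  show "1 * a = a" by transfer (auto simp: cl)
  show "(a + b) * c = a * c + b * c" by transfer (auto simp: cl algebra_simps)
  show "(0 :: 'a padic) \<noteq> 1"
    by transfer (auto simp: padic_rel_def rat_padic_abs_minus[OF prime, of 1, simplified] LIMSEQ_const_iff)
  show "a div b = a * inverse b" by (simp add: divide_padic_def)
  show "inverse (0 :: 'a padic) = 0" by transfer (simp add: padic_rel_refl)
  show "inverse a * a = 1" if "a \<noteq> 0"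
    using that
  proof transfer
    fix X :: "nat \<Rightarrow> rat"
    assume X: "padic_rel CARD('a) X X" and "\<not> padic_rel CARD('a) X (\<lambda>_. 0)"
    hence nz: "\<not> (\<lambda>n. rat_padic_abs CARD('a) (X n)) \<longlonglongrightarrow> 0" and cX: "padic_Cauchy CARD('a) X"
      by (auto simp: padic_rel_def)
    obtain c where c: "c > 0" "\<forall>\<^sub>F n in sequentially. rat_padic_abs CARD('a) (X n) > c"
      using padic_not_null_bound[OF prime cX nz] by blast
    have "padic_rel CARD('a) (\<lambda>n. inverse (X n) * X n) (\<lambda>_. 1)"
    proof (rule padic_relI[OF prime _ _ tendsto_const])
      show "\<forall>\<^sub>F n in sequentially. rat_padic_abs CARD('a) (inverse (X n) * X n - 1) \<le> 0"
        using c(2) proof eventually_elim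
          case (elim n)
          hence "X n \<noteq> 0" using c(1) by auto
          thus ?case by simp
        qed
    qed (use cX nz in \<open>auto intro!: padic_Cauchy_mult[OF prime] padic_Cauchy_inverse[OF prime]\<close>)
    thus "padic_rel CARD('a)
       (\<lambda>n. (if (\<lambda>n. rat_padic_abs CARD('a) (X n)) \<longlonglongrightarrow> 0 then \<lambda>_. 0 else (\<lambda>n. inverse (X n))) n * X n)
       (\<lambda>_. 1)"
      using nz by simp
  qed
qed

end

lift_definition padic_abs :: "'p::prime_card padic \<Rightarrow> real" is
  "\<lambda>X. lim (\<lambda>n. rat_padic_abs CARD('p) (X n))"
proof -
  fix X Y assume "padic_rel CARD('p) X Y"
  from padic_rel_abs_tendsto_iff[OF prime_card this]
  show "lim (\<lambda>n. rat_padic_abs CARD('p) (X n)) = lim (\<lambda>n. rat_padic_abs CARD('p) (Y n))"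
    by (simp add: lim_def)
qed

lemma padic_Cauchy_abs_tendsto_lim:
  assumes "prime p" "padic_rel p X X"
  shows "(\<lambda>n. rat_padic_abs p (X n)) \<longlonglongrightarrow> lim (\<lambda>n. rat_padic_abs p (X n))"
  using assms padic_Cauchy_convergent convergent_LIMSEQ_iff unfolding padic_rel_def by blast

lemma padic_abs_mult: "padic_abs (x * y) = padic_abs x * padic_abs (y :: 'p::prime_card padic)"
proof transfer
  fix X Y :: "nat \<Rightarrow> rat"
  assume X: "padic_rel CARD('p) X X" and Y: "padic_rel CARD('p) Y Y"
  show "lim (\<lambda>n. rat_padic_abs CARD('p) (X n * Y n))
      = lim (\<lambda>n. rat_padic_abs CARD('p) (X n)) * lim (\<lambda>n. rat_padic_abs CARD('p) (Y n))"
    unfolding rat_padic_abs_mult[OF prime_card]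
    by (intro limI tendsto_mult padic_Cauchy_abs_tendsto_lim prime_card X Y)
qed

lemma padic_abs_nonneg: "padic_abs (x :: 'p::prime_card padic) \<ge> 0"
proof transfer
  fix X :: "nat \<Rightarrow> rat" assume "padic_rel CARD('p) X X"
  from padic_Cauchy_abs_tendsto_lim[OF prime_card this]
  show "0 \<le> lim (\<lambda>n. rat_padic_abs CARD('p) (X n))" by (rule LIMSEQ_le_const) auto
qed

lemma padic_abs_eq_0_iff: "padic_abs x = 0 \<longleftrightarrow> x = (0 :: 'p::prime_card padic)"
proof transfer
  fix X :: "nat \<Rightarrow> rat" assume X: "padic_rel CARD('p) X X"
  have "padic_rel CARD('p) X (\<lambda>_. 0) \<longleftrightarrow> (\<lambda>n. rat_padic_abs CARD('p) (X n)) \<longlonglongrightarrow> 0"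
    using X by (simp add: padic_rel_def)
  thus "lim (\<lambda>n. rat_padic_abs CARD('p) (X n)) = 0 \<longleftrightarrow> padic_rel CARD('p) X (\<lambda>_. 0)"
    using padic_Cauchy_abs_tendsto_lim[OF prime_card X] limI by metis
qed

section \<open>The projective line\<close>

definition proj_rel :: "'a::field ^ 2 \<Rightarrow> 'a ^ 2 \<Rightarrow> bool" where
  "proj_rel u v \<longleftrightarrow> u \<noteq> 0 \<and> v \<noteq> 0 \<and> (\<exists>c. c \<noteq> 0 \<and> v = c *s u)"

lemma proj_rel_part_equivp: "part_equivp (proj_rel :: 'a::field ^ 2 \<Rightarrow> 'a ^ 2 \<Rightarrow> bool)"
proof (rule part_equivpI)
  have "proj_rel 1 (1 :: 'a ^ 2)"
    by (auto simp: proj_rel_def vec_eq_iff intro!: exI[of _ 1])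
  thus "\<exists>u. proj_rel u (u :: 'a ^ 2)" ..
  show "symp (proj_rel :: 'a ^ 2 \<Rightarrow> _)"
  proof (rule sympI)
    fix u v :: "'a ^ 2" assume "proj_rel u v"
    then obtain c where "u \<noteq> 0" "v \<noteq> 0" "c \<noteq> 0" "v = c *s u" by (auto simp: proj_rel_def)
    thus "proj_rel v u" unfolding proj_rel_def
      by (auto intro!: exI[of _ "inverse c"] simp: vector_smult_assoc)
  qed
  show "transp (proj_rel :: 'a ^ 2 \<Rightarrow> _)"
    by (rule transpI) (auto simp: proj_rel_def vector_smult_assoc intro: no_zero_divisors)
qed

quotient_type (overloaded) 'a proj_line = "'a::field ^ 2" / partial: "proj_rel :: 'a ^ 2 \<Rightarrow> 'a ^ 2 \<Rightarrow> bool"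
  by (rule proj_rel_part_equivp)

text \<open>\<open>abs_proj_line v\<close> is the point with homogeneous coordinates \<open>v\<close>; it is meaningful only
  for \<open>v \<noteq> 0\<close>.\<close>

definition cf_matrix :: "nat \<Rightarrow> 'a::field ^ 2 ^ 2" where
  "cf_matrix a = vector [vector [0, 1], vector [1, of_nat a]]"

definition cf_word_matrix :: "nat list \<Rightarrow> 'a::field ^ 2 ^ 2" where
  "cf_word_matrix u = foldr (\<lambda>a M. cf_matrix a ** M) u (mat 1)"

definition is_eigenvector :: "'a::field ^ 'n ^ 'n \<Rightarrow> 'a ^ 'n \<Rightarrow> bool" where
  "is_eigenvector M v \<longleftrightarrow> v \<noteq> 0 \<and> (\<exists>c. M *v v = c *s v)"

lemma cf_matrix_mult_vec: "cf_matrix a *v v = vector [v $ 2, v $ 1 + of_nat a * v $ 2]"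
  by (simp add: cf_matrix_def vec_eq_iff matrix_vector_mult_def forall_2 sum_2)

lift_definition cf_act :: "nat \<Rightarrow> 'a::field proj_line \<Rightarrow> 'a proj_line" is
  "\<lambda>a v. cf_matrix a *v v"
proof -
  fix a :: nat and u v :: "'a ^ 2" assume uv: "proj_rel u v"
  then obtain c where c: "u \<noteq> 0" "v \<noteq> 0" "c \<noteq> 0" "v = c *s u" by (auto simp: proj_rel_def)
  have nz: "cf_matrix a *v x \<noteq> 0" if "x \<noteq> 0" for x :: "'a ^ 2"
    using that by (auto simp: vec_eq_iff forall_2 cf_matrix_mult_vec)
  have "cf_matrix a *v v = c *s (cf_matrix a *v u)"
    by (simp add: c vec_eq_iff forall_2 cf_matrix_mult_vec algebra_simps)
  thus "proj_rel (cf_matrix a *v u) (cf_matrix a *v v)"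
    using c nz unfolding proj_rel_def by blast
qed

section \<open>Badly approximable pairs\<close>

lift_definition is_PBad :: "real \<Rightarrow> 'p::prime_card padic proj_line \<Rightarrow> bool" is
  "\<lambda>\<epsilon> q. \<forall>a b :: int. (a, b) \<noteq> (0, 0) \<longrightarrow>
     padic_abs (of_int a * q $ 1 + of_int b * q $ 2) / max (padic_abs (q $ 1)) (padic_abs (q $ 2))
       \<ge> \<epsilon> / max (real_of_int a ^ 2) (real_of_int b ^ 2)"
proof -
  fix \<epsilon> :: real and u v :: "'p padic ^ 2" assume "proj_rel u v"
  then obtain c where c: "c \<noteq> 0" "v = c *s u" by (auto simp: proj_rel_def)
  have pos: "padic_abs c > 0" using c padic_abs_nonneg[of c] padic_abs_eq_0_iff[of c] by linarith
  have "padic_abs (of_int a * v $ 1 + of_int b * v $ 2) / max (padic_abs (v $ 1)) (padic_abs (v $ 2))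
      = padic_abs (of_int a * u $ 1 + of_int b * u $ 2) / max (padic_abs (u $ 1)) (padic_abs (u $ 2))"
    for a b :: int
  proof -
    have "of_int a * v $ 1 + of_int b * v $ 2 = c * (of_int a * u $ 1 + of_int b * u $ 2)"
      by (simp add: c algebra_simps)
    moreover have "max (padic_abs (v $ 1)) (padic_abs (v $ 2))
        = padic_abs c * max (padic_abs (u $ 1)) (padic_abs (u $ 2))"
      using pos by (simp add: c padic_abs_mult max_mult_distrib_left)
    ultimately show ?thesis using pos by (simp add: padic_abs_mult)
  qed
  thus "(\<forall>a b :: int. (a, b) \<noteq> (0, 0) \<longrightarrow>
     padic_abs (of_int a * u $ 1 + of_int b * u $ 2) / max (padic_abs (u $ 1)) (padic_abs (u $ 2))
       \<ge> \<epsilon> / max (real_of_int a ^ 2) (real_of_int b ^ 2)) =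
    (\<forall>a b :: int. (a, b) \<noteq> (0, 0) \<longrightarrow>
     padic_abs (of_int a * v $ 1 + of_int b * v $ 2) / max (padic_abs (v $ 1)) (padic_abs (v $ 2))
       \<ge> \<epsilon> / max (real_of_int a ^ 2) (real_of_int b ^ 2))"
    by simp
qed

definition PBad :: "real \<Rightarrow> 'p::prime_card padic proj_line set" where
  "PBad \<epsilon> = {q. is_PBad \<epsilon> q}"

definition shift_pair :: "nat stream \<times> 'a::field proj_line \<Rightarrow> nat stream \<times> 'a proj_line" where
  "shift_pair = (\<lambda>(w, q). (stl w, cf_act (shd w) q))"

definition LMad_eps :: "real \<Rightarrow> (nat stream \<times> 'p::prime_card padic proj_line) set" where
  "LMad_eps \<epsilon> = {(w, x). w \<in> streams {1..} \<and>
     (\<forall>n. (shift_pair ^^ n) (w, x) \<in> streams {1..nat \<lfloor>1 / \<epsilon>\<rfloor> + 1} \<times> PBad \<epsilon>)}"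

definition LMad :: "(nat stream \<times> 'p::prime_card padic proj_line) set" where
  "LMad = (\<Union>\<epsilon>\<in>{0<..}. LMad_eps \<epsilon>)"

definition is_period :: "nat stream \<Rightarrow> nat \<Rightarrow> bool" where
  "is_period w k \<longleftrightarrow> k > 0 \<and> sdrop k w = w"

definition is_minimal_period :: "nat stream \<Rightarrow> nat \<Rightarrow> bool" where
  "is_minimal_period w l \<longleftrightarrow> is_period w l \<and> (\<forall>k. is_period w k \<longrightarrow> l \<le> k)"

end

theory Submission
  imports Defs "HOL-Number_Theory.Cong"
begin

text \<open>
  Shifting by the period \<open>l\<close> acts on the projective line by \<open>B = A\<^sub>w\<^sub>l\<^sup>T\<close>, an integral hyperbolic
  matrix, so the eigenvectors of \<open>B\<close> are the points whose pair with \<open>w\<close> is periodic. Such a point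
  satisfies a quadratic equation without rational solutions, and Liouville's argument shows that it
  is badly approximable; its orbit is finite. If \<open>v\<close> is not an eigenvector, the closure of its
  \<open>B\<close>-orbit contains a neighbourhood of \<open>v\<close> and hence rational points: for an integer vector \<open>r\<close>
  close to \<open>v\<close>, the sequence \<open>n \<mapsto> det (r, B\<^sup>n v)\<close> is a linear recurrence with coefficients \<open>tr B\<close>
  and \<open>det B\<close>. Along a suitable arithmetic progression these become \<open>2\<close> and \<open>1\<close> modulo \<open>p\<^sup>2\<close>, and
  a Hensel-type argument gives terms arbitrarily close to \<open>0\<close>, which contradicts the uniform bound
  in \<open>PBad\<close>.
\<close>

section \<open>The \<open>p\<close>-adic absolute value\<close>

lemma padic_abs_abs_padic_const:
  "padic_abs (abs_padic (\<lambda>_. c) :: 'p::prime_card padic) = rat_padic_abs CARD('p) c"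
  by (subst padic_abs.abs_eq) (auto simp: padic_rel_refl_iff)

lemma padic_abs_add:
  fixes x y :: "'p::prime_card padic"
  shows "padic_abs (x + y) \<le> max (padic_abs x) (padic_abs y)"
proof transfer
  fix X Y :: "nat \<Rightarrow> rat"
  assume X: "padic_rel CARD('p) X X" and Y: "padic_rel CARD('p) Y Y"
  show "lim (\<lambda>n. rat_padic_abs CARD('p) (X n + Y n))
      \<le> max (lim (\<lambda>n. rat_padic_abs CARD('p) (X n))) (lim (\<lambda>n. rat_padic_abs CARD('p) (Y n)))"
  proof (rule LIMSEQ_le[OF padic_Cauchy_abs_tendsto_lim tendsto_max])
    show "\<exists>N. \<forall>n\<ge>N. rat_padic_abs CARD('p) (X n + Y n)
        \<le> max (rat_padic_abs CARD('p) (X n)) (rat_padic_abs CARD('p) (Y n))"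
      by (simp add: rat_padic_abs_add[OF prime_card])
  qed (intro padic_Cauchy_abs_tendsto_lim padic_rel_add prime_card X Y)+
qed

lemma padic_abs_0 [simp]: "padic_abs (0 :: 'p::prime_card padic) = 0"
  by (simp add: padic_abs_eq_0_iff)

lemma padic_abs_1 [simp]: "padic_abs (1 :: 'p::prime_card padic) = 1"
  using padic_abs_abs_padic_const[of 1, where 'p='p] by (simp add: one_padic_def)

lemma padic_abs_minus [simp]: "padic_abs (- x) = padic_abs (x :: 'p::prime_card padic)"
proof -
  have "padic_abs (- 1 :: 'p padic) ^ 2 = 1"
    using padic_abs_mult[of "- 1" "- 1 :: 'p padic"] by (simp add: power2_eq_square)
  hence "padic_abs (- 1 :: 'p padic) = 1"
    using padic_abs_nonneg[of "- 1 :: 'p padic"] by (auto simp: power2_eq_1_iff)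
  thus ?thesis using padic_abs_mult[of "- 1" x] by simp
qed

lemma padic_abs_minus_commute: "padic_abs (x - y) = padic_abs (y - x :: 'p::prime_card padic)"
  using padic_abs_minus[of "x - y"] by simp

lemma padic_abs_pos_iff: "padic_abs x > 0 \<longleftrightarrow> x \<noteq> (0 :: 'p::prime_card padic)"
  using padic_abs_nonneg[of x] padic_abs_eq_0_iff[of x] by linarith

lemma padic_abs_divide: "padic_abs (x / y) = padic_abs x / padic_abs (y :: 'p::prime_card padic)"
proof (cases "y = 0")
  case False
  thus ?thesis using padic_abs_mult[of "x / y" y] by (simp add: padic_abs_eq_0_iff field_simps)
qed simp

lemma padic_abs_add_le:
  fixes x y :: "'p::prime_card padic"
  shows "padic_abs x \<le> e \<Longrightarrow> padic_abs y \<le> e \<Longrightarrow> padic_abs (x + y) \<le> e"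
  using padic_abs_add[of x y] by linarith

lemma padic_abs_diff_le:
  fixes x y :: "'p::prime_card padic"
  shows "padic_abs x \<le> e \<Longrightarrow> padic_abs y \<le> e \<Longrightarrow> padic_abs (x - y) \<le> e"
  using padic_abs_add_le[of x e "- y"] by simp

lemma padic_abs_sum_le:
  fixes f :: "'i \<Rightarrow> 'p::prime_card padic"
  assumes "\<And>i. i \<in> I \<Longrightarrow> padic_abs (f i) \<le> e" and "e \<ge> 0"
  shows "padic_abs (sum f I) \<le> e"
  using assms by (induction I rule: infinite_finite_induct) (auto intro: padic_abs_add_le)

lemma padic_abs_mult_le:
  fixes x y :: "'p::prime_card padic"
  shows "padic_abs x \<le> a \<Longrightarrow> padic_abs y \<le> b \<Longrightarrow> padic_abs (x * y) \<le> a * b"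
  unfolding padic_abs_mult by (meson mult_mono order_trans padic_abs_nonneg)

lemma padic_abs_integral_mult_le:
  fixes x y :: "'p::prime_card padic"
  shows "padic_abs x \<le> 1 \<Longrightarrow> padic_abs y \<le> e \<Longrightarrow> padic_abs (x * y) \<le> e"
  using padic_abs_mult_le[of x 1 y e] by simp

lemma padic_abs_eq_of_diff_less:
  fixes x y :: "'p::prime_card padic"
  assumes "padic_abs (x - y) < padic_abs y"
  shows "padic_abs x = padic_abs y"
  using padic_abs_add[of "x - y" y] padic_abs_add[of x "y - x"] assms
  by (simp add: padic_abs_minus_commute[of y])

lemma abs_padic_const_add:
  "abs_padic (\<lambda>_. a) + abs_padic (\<lambda>_. b) = (abs_padic (\<lambda>_. a + b) :: 'p::prime_card padic)"
  by (subst plus_padic.abs_eq) (auto simp: padic_rel_refl_iff)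

lemma abs_padic_const_minus:
  "- abs_padic (\<lambda>_. a) = (abs_padic (\<lambda>_. - a) :: 'p::prime_card padic)"
  by (subst uminus_padic.abs_eq) (auto simp: padic_rel_refl_iff)

lemma abs_padic_const_mult:
  "abs_padic (\<lambda>_. a) * abs_padic (\<lambda>_. b) = (abs_padic (\<lambda>_. a * b) :: 'p::prime_card padic)"
  by (subst times_padic.abs_eq) (auto simp: padic_rel_refl_iff)

lemma of_int_padic: "(of_int a :: 'p::prime_card padic) = abs_padic (\<lambda>_. of_int a)"
proof (induction a rule: int_induct[of _ 0])
  case (step1 i)
  thus ?case by (simp add: one_padic_def abs_padic_const_add)
next
  case (step2 i)
  thus ?case
    by (simp add: one_padic_def abs_padic_const_add abs_padic_const_minus
        flip: add_uminus_conv_diff del: add_uminus_conv_diff)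
qed (simp add: zero_padic_def)

instance padic :: (prime_card) field_char_0
proof
  show "inj (of_nat :: nat \<Rightarrow> 'a padic)"
  proof (rule injI)
    fix m n :: nat
    assume "(of_nat m :: 'a padic) = of_nat n"
    hence "padic_abs (of_int (int m - int n) :: 'a padic) = 0" by simp
    hence "rat_padic_abs CARD('a) (of_int (int m - int n)) = 0"
      by (simp only: of_int_padic padic_abs_abs_padic_const)
    thus "m = n" by (simp add: rat_padic_abs_eq_0_iff[OF prime_card])
  qed
qed

lemma of_rat_padic: "(of_rat c :: 'p::prime_card padic) = abs_padic (\<lambda>_. c)"
proof -
  obtain a b where c: "c = of_int a / of_int b" and b: "b > 0" by (rule rat_as_fraction)
  have "abs_padic (\<lambda>_. c) * of_int b = (of_int a :: 'p padic)"
    using b by (simp add: of_int_padic abs_padic_const_mult c)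
  thus ?thesis using b by (simp add: c of_rat_divide field_simps)
qed

lemma padic_abs_of_rat: "padic_abs (of_rat c :: 'p::prime_card padic) = rat_padic_abs CARD('p) c"
  by (simp add: of_rat_padic padic_abs_abs_padic_const)

lemma padic_abs_of_int:
  assumes "a \<noteq> 0"
  shows "padic_abs (of_int a :: 'p::prime_card padic)
    = 1 / real CARD('p) ^ multiplicity (int CARD('p)) a"
  using padic_abs_of_rat[of "of_int a", where 'p='p]
    rat_padic_abs_fraction[OF prime_card assms, of 1, where 'a1='p]
  by (simp add: power_int_minus field_simps)

lemma padic_abs_of_int_le_iff:
  "padic_abs (of_int a :: 'p::prime_card padic) \<le> 1 / real CARD('p) ^ k \<longleftrightarrow> int CARD('p) ^ k dvd a"
proof (cases "a = 0")
  case False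
  have "\<not> is_unit (int CARD('p))" using nontriv[where 'a='p] by simp
  hence "int CARD('p) ^ k dvd a \<longleftrightarrow> k \<le> multiplicity (int CARD('p)) a"
    by (rule power_dvd_iff_le_multiplicity[OF False])
  thus ?thesis
    using nontriv[where 'a='p] False by (simp add: padic_abs_of_int frac_le_eq field_simps)
qed simp

lemma padic_abs_of_int_le_1: "padic_abs (of_int a :: 'p::prime_card padic) \<le> 1"
  using padic_abs_of_int_le_iff[of a 0, where 'p='p] by simp

lemma padic_abs_le_1_of_near_int:
  fixes x :: "'p::prime_card padic"
  assumes "padic_abs (x - of_int a) \<le> e" and "e \<le> 1"
  shows "padic_abs x \<le> 1"
  using padic_abs_add_le[of "x - of_int a" 1 "of_int a"] padic_abs_of_int_le_1[of a, where 'p='p] assms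
  by simp

lemma padic_abs_of_int_unit:
  "\<bar>a\<bar> = 1 \<Longrightarrow> padic_abs (of_int a :: 'p::prime_card padic) = 1"
  by (auto simp: abs_if split: if_splits)

lemma padic_abs_of_nat_le_1: "padic_abs (of_nat a :: 'p::prime_card padic) \<le> 1"
  using padic_abs_of_int_le_1[of "int a", where 'p='p] by simp

lemma padic_abs_of_int_not_dvd:
  "\<not> int CARD('p) dvd a \<Longrightarrow> padic_abs (of_int a :: 'p::prime_card padic) = 1"
  by (subst padic_abs_of_int) (auto simp: not_dvd_imp_multiplicity_0)

lemma padic_abs_prime: "padic_abs (of_nat CARD('p) :: 'p::prime_card padic) = 1 / real CARD('p)"
  using padic_abs_of_int[of "int CARD('p)", where 'p='p] nontriv[where 'a='p]
  by (simp add: multiplicity_self)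

lemma padic_abs_of_int_ge:
  assumes "a \<noteq> 0"
  shows "padic_abs (of_int a :: 'p::prime_card padic) \<ge> 1 / real_of_int \<bar>a\<bar>"
proof -
  let ?k = "multiplicity (int CARD('p)) a"
  have "int CARD('p) ^ ?k \<le> \<bar>a\<bar>"
    using dvd_imp_le_int[OF assms multiplicity_dvd[of "int CARD('p)"]] by simp
  hence "real CARD('p) ^ ?k \<le> real_of_int \<bar>a\<bar>"
    by (metis of_int_le_iff of_int_of_nat_eq of_int_power)
  thus ?thesis using assms by (simp add: padic_abs_of_int divide_left_mono)
qed

lemma prime_power_inverse_less:
  assumes "e > 0"
  shows "\<exists>k. 1 / real CARD('p::prime_card) ^ k < e"
  using real_arch_pow_inv[OF assms, of "1 / real CARD('p)"] nontriv[where 'a='p]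
  by (auto simp: power_one_over)

lemma padic_rat_dense:
  fixes x :: "'p::prime_card padic"
  assumes e: "e > 0"
  shows "\<exists>c. padic_abs (x - of_rat c) \<le> e"
proof -
  obtain X where X: "padic_Cauchy CARD('p) X" "x = abs_padic X"
    using Quotient_padic[where 'p='p]
    by (metis Quotient_abs_rep Quotient_rep_reflp padic_rel_refl_iff)
  obtain M where M: "\<And>n. n \<ge> M \<Longrightarrow> rat_padic_abs CARD('p) (X n - X M) < e"
    using X(1) e unfolding padic_Cauchy_def by blast
  have cauchy: "padic_Cauchy CARD('p) (\<lambda>n. X n + - X M)"
    by (intro padic_Cauchy_add prime_card X(1)) auto
  have "x - of_rat (X M) = abs_padic (\<lambda>n. X n + - X M)"
    unfolding X(2) diff_conv_add_uminus of_rat_padic abs_padic_const_minus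
    by (subst plus_padic.abs_eq) (auto simp: padic_rel_refl_iff X(1))
  hence "padic_abs (x - of_rat (X M)) = lim (\<lambda>n. rat_padic_abs CARD('p) (X n + - X M))"
    using cauchy by (simp only: padic_abs.abs_eq padic_rel_refl_iff)
  also have "\<dots> \<le> e"
    by (rule LIMSEQ_le_const2[OF padic_Cauchy_abs_tendsto_lim[OF prime_card]])
       (use cauchy M in \<open>auto simp: padic_rel_refl_iff intro!: exI[of _ M] less_imp_le\<close>)
  finally show ?thesis ..
qed

lemma padic_integral_of_rat_near_nat:
  assumes c: "padic_abs (of_rat c :: 'p::prime_card padic) \<le> 1"
  shows "\<exists>j::nat. padic_abs (of_rat c - of_nat j :: 'p padic) \<le> 1 / real CARD('p) ^ k"
proof -
  let ?p = "int CARD('p)"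
  obtain a b where q: "quotient_of c = (a, b)" by fastforce
  have c_eq: "c = of_int a / of_int b" and b: "b \<noteq> 0" and coprime: "coprime a b"
    using quotient_of_div[OF q] quotient_of_denom_pos[OF q] quotient_of_coprime[OF q] by auto
  have dvd_iff: "?p dvd z \<longleftrightarrow> padic_abs (of_int z :: 'p padic) \<le> 1 / real CARD('p)" for z
    using padic_abs_of_int_le_iff[of z 1, where 'p='p] by simp
  have p_b: "\<not> ?p dvd b"
  proof
    assume pb: "?p dvd b"
    have "padic_abs (of_int a :: 'p padic) \<le> padic_abs (of_int b :: 'p padic)"
      using c b by (simp add: c_eq of_rat_divide padic_abs_divide divide_le_eq padic_abs_pos_iff)
    also have "\<dots> \<le> 1 / real CARD('p)" using pb by (simp only: dvd_iff)
    finally have "?p dvd a" by (simp only: dvd_iff)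
    thus False using coprime pb nontriv[where 'a='p] coprime_common_divisor by fastforce
  qed
  hence "coprime b (?p ^ k)"
    using prime_card_int[where 'a='p] prime_imp_coprime[of ?p b] by (simp add: coprime_commute)
  then obtain i where "[b * i = 1] (mod ?p ^ k)" using cong_solve_coprime_int by blast
  hence "[a * (b * i) = a * 1] (mod ?p ^ k)" by (intro cong_mult) auto
  moreover define j where "j = (a * i) mod ?p ^ k"
  moreover have "[b * j = b * (a * i)] (mod ?p ^ k)" unfolding j_def by (intro cong_mult) auto
  ultimately have dvd: "?p ^ k dvd a - b * j"
    by (metis cong_iff_dvd_diff cong_sym cong_trans mult.left_commute mult_1_right)
  have "j \<ge> 0" by (simp add: j_def)
  hence "of_rat c - of_nat (nat j) = (of_int (a - b * j) / of_int b :: 'p padic)"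
    using b by (simp add: c_eq of_rat_divide field_simps)
  hence "padic_abs (of_rat c - of_nat (nat j) :: 'p padic)
      = padic_abs (of_int (a - b * j) :: 'p padic)"
    by (simp only: padic_abs_divide padic_abs_of_int_not_dvd[OF p_b] div_by_1)
  also have "\<dots> \<le> 1 / real CARD('p) ^ k" using dvd by (simp only: padic_abs_of_int_le_iff)
  finally show ?thesis ..
qed

lemma padic_nat_dense:
  fixes x :: "'p::prime_card padic"
  assumes x: "padic_abs x \<le> 1" and e: "e > 0"
  shows "\<exists>j::nat. padic_abs (x - of_nat j) < e"
proof -
  obtain k where k: "1 / real CARD('p) ^ k < e" using prime_power_inverse_less[OF e] ..
  let ?e = "1 / real CARD('p) ^ k"
  have pos: "?e > 0" and le_1: "?e \<le> 1" by simp_all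
  obtain c where c: "padic_abs (x - of_rat c) \<le> ?e" using padic_rat_dense[OF pos] ..
  hence "padic_abs (x - (x - of_rat c)) \<le> 1" by (intro padic_abs_diff_le x order_trans[OF c le_1])
  hence "padic_abs (of_rat c :: 'p padic) \<le> 1" by simp
  then obtain j where "padic_abs (of_rat c - of_nat j :: 'p padic) \<le> ?e"
    using padic_integral_of_rat_near_nat by blast
  hence "padic_abs ((x - of_rat c) + (of_rat c - of_nat j)) \<le> ?e" by (intro padic_abs_add_le c)
  thus ?thesis using k by (auto intro: le_less_trans)
qed

section \<open>Binary linear recurrences\<close>

definition binary_recurrence :: "'a::comm_ring_1 \<Rightarrow> 'a \<Rightarrow> (nat \<Rightarrow> 'a) \<Rightarrow> bool" where
  "binary_recurrence t d f \<longleftrightarrow> (\<forall>n. f (n + 2) = t * f (n + 1) - d * f n)"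

lemma binary_recurrenceD: "binary_recurrence t d f \<Longrightarrow> f (n + 2) = t * f (n + 1) - d * f n"
  by (simp add: binary_recurrence_def)

lemma binary_recurrence_divide:
  fixes f :: "nat \<Rightarrow> 'a::field"
  shows "binary_recurrence t d f \<Longrightarrow> binary_recurrence t d (\<lambda>n. f n / c)"
  by (simp add: binary_recurrence_def diff_divide_distrib)

fun lucasU :: "'a::comm_ring_1 \<Rightarrow> 'a \<Rightarrow> nat \<Rightarrow> 'a" where
  "lucasU t d 0 = 0"
| "lucasU t d (Suc 0) = 1"
| "lucasU t d (Suc (Suc n)) = t * lucasU t d (Suc n) - d * lucasU t d n"

fun lucasV :: "'a::comm_ring_1 \<Rightarrow> 'a \<Rightarrow> nat \<Rightarrow> 'a" where
  "lucasV t d 0 = 2"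
| "lucasV t d (Suc 0) = t"
| "lucasV t d (Suc (Suc n)) = t * lucasV t d (Suc n) - d * lucasV t d n"

lemma binary_recurrence_lucasV: "binary_recurrence t d (lucasV t d)"
  by (simp add: binary_recurrence_def)

lemma of_int_lucasU: "of_int (lucasU t d n) = lucasU (of_int t) (of_int d) n"
  by (induction t d n rule: lucasU.induct) simp_all

lemma of_int_lucasV: "of_int (lucasV t d n) = lucasV (of_int t) (of_int d) n"
  by (induction t d n rule: lucasV.induct) simp_all

lemma binary_recurrence_eq_lucasU:
  assumes "binary_recurrence t d f" and "f 0 = 0"
  shows "f n = lucasU t d n * f 1"
proof (induction n rule: induct_nat_012)
  case (ge2 n)
  thus ?case using binary_recurrenceD[OF assms(1), of n] by (simp add: algebra_simps)
qed (use assms in auto)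

lemma binary_recurrence_stride:
  assumes f: "binary_recurrence t d f"
  shows "f (n + 2 * m) = lucasV t d m * f (n + m) - d ^ m * f n"
proof (induction m arbitrary: n rule: induct_nat_012)
  case (ge2 m)
  have "f (n + 2 * Suc (Suc m)) = t * f (n + 1 + 2 * Suc m) - d * f (n + 2 + 2 * m)"
    using binary_recurrenceD[OF f, of "n + 2 + 2 * m"] by (simp add: algebra_simps numeral_eq_Suc)
  also have "f (n + 1 + 2 * Suc m) = lucasV t d (Suc m) * f (n + 2 + m) - d * d ^ m * f (n + 1)"
    using ge2.IH(2)[of "n + 1"] by (simp add: numeral_eq_Suc)
  also have "f (n + 2 + 2 * m) = lucasV t d m * f (n + 2 + m) - d ^ m * (t * f (n + 1) - d * f n)"
    using ge2.IH(1)[of "n + 2"] binary_recurrenceD[OF f, of n] by simp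
  finally show ?case by (simp add: algebra_simps numeral_eq_Suc)
qed (use f in \<open>auto simp: binary_recurrence_def\<close>)

lemma binary_recurrence_subsequence:
  assumes "binary_recurrence t d f"
  shows "binary_recurrence (lucasV t d m) (d ^ m) (\<lambda>n. f (k + n * m))"
  unfolding binary_recurrence_def
proof
  fix n
  show "f (k + (n + 2) * m) = lucasV t d m * f (k + (n + 1) * m) - d ^ m * f (k + n * m)"
    using binary_recurrence_stride[OF assms, of "k + n * m" m]
    by (simp add: algebra_simps mult_2_right)
qed

lemma lucasU_pos:
  fixes t d :: int
  assumes "\<bar>d\<bar> = 1" "t > 0" "4 * d < t\<^sup>2" "n > 0"
  shows "lucasU t d n > 0"
proof -
  have t: "d = 1 \<Longrightarrow> t \<ge> 2" using assms(2,3) by (cases "t = 1") auto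
  have "0 \<le> lucasU t d n \<and> lucasU t d n \<le> lucasU t d (Suc n) \<and> 0 < lucasU t d (Suc n)" for n
  proof (induction n)
    case (Suc n)
    have "d * lucasU t d n \<le> (t - 1) * lucasU t d (Suc n)"
    proof (cases "d = 1")
      case True
      hence "1 * lucasU t d (Suc n) \<le> (t - 1) * lucasU t d (Suc n)"
        using Suc t by (intro mult_right_mono) auto
      moreover have "d * lucasU t d n = lucasU t d n" using True by simp
      ultimately show ?thesis using Suc by linarith
    next
      case False
      hence "d = - 1" using assms(1) by linarith
      moreover have "0 \<le> (t - 1) * lucasU t d (Suc n)"
        using Suc assms(2) by (intro mult_nonneg_nonneg) auto
      ultimately show ?thesis using Suc by simp
    qed
    thus ?case using Suc by (simp add: algebra_simps)
  qed simp
  thus ?thesis using assms(4) by (metis gr0_implies_Suc)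
qed

lemma lucasU_minus: "lucasU (- t) d n = - ((- 1) ^ n * lucasU t d n)"
  by (induction t d n rule: lucasU.induct) (simp_all add: algebra_simps)

lemma lucasU_nonzero:
  fixes t d :: int
  assumes "\<bar>d\<bar> = 1" "t \<noteq> 0" "4 * d < t\<^sup>2" "n > 0"
  shows "lucasU t d n \<noteq> 0"
proof (cases "t > 0")
  case True
  thus ?thesis using lucasU_pos[OF assms(1) True assms(3,4)] by simp
next
  case False
  thus ?thesis using lucasU_pos[of d "- t" n] assms by (auto simp: lucasU_minus)
qed

lemma backward_determined_finite_range_returns:
  fixes s :: "nat \<Rightarrow> 'a"
  assumes finite: "finite (range s)"
    and backward: "\<And>i j. s (Suc i) = s (Suc j) \<Longrightarrow> s i = s j"
  shows "\<exists>m>0. s m = s 0"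
proof -
  have "\<not> inj s" using finite finite_imageD by blast
  then obtain i j where "s i = s j" "i < j" by (metis injI linorder_neqE_nat)
  moreover have "s i = s (i + k) \<Longrightarrow> s 0 = s k" for i k
    by (induction i) (auto dest: backward)
  ultimately have "s 0 = s (j - i)" by (metis le_add_diff_inverse less_imp_le)
  thus ?thesis using \<open>i < j\<close> by (intro exI[of _ "j - i"]) auto
qed

lemma binary_recurrence_returns_mod:
  fixes f :: "nat \<Rightarrow> int"
  assumes f: "binary_recurrence t d f" and d: "\<bar>d\<bar> = 1" and q: "q > 0"
  shows "\<exists>m>0. [f m = f 0] (mod q)"
proof -
  define s where "s n = (f n mod q, f (Suc n) mod q)" for n
  have "\<exists>m>0. s m = s 0"
  proof (rule backward_determined_finite_range_returns)
    have "range s \<subseteq> {0..<q} \<times> {0..<q}" using q by (auto simp: s_def)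
    thus "finite (range s)" by (rule finite_subset) auto
  next
    fix i j
    assume "s (Suc i) = s (Suc j)"
    hence eq: "[f (i + 1) = f (j + 1)] (mod q)" "[f (i + 2) = f (j + 2)] (mod q)"
      by (simp_all add: s_def cong_def)
    have "d * d = 1" using d by (simp add: abs_if split: if_splits)
    moreover have "d * (t * f (n + 1) - f (n + 2)) = (d * d) * f n" for n
      unfolding binary_recurrenceD[OF f] by (simp add: algebra_simps)
    ultimately have backward: "f n = d * (t * f (n + 1) - f (n + 2))" for n by simp
    have "[f i = f j] (mod q)"
      unfolding backward[of i] backward[of j] by (intro cong_mult cong_diff cong_refl eq)
    thus "s i = s j" using eq(1) by (simp add: s_def cong_def)
  qed
  thus ?thesis by (auto simp: s_def cong_def)
qed

lemma lucasV_returns_mod: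
  fixes t d q :: int
  assumes d: "\<bar>d\<bar> = 1" and q: "q > 0"
  obtains m where "m > 0" "[lucasV t d m = 2] (mod q)" "d ^ m = 1"
proof -
  have "d\<^sup>2 = 1" using d by (simp add: power2_eq_1_iff abs_if split: if_splits)
  moreover have "binary_recurrence (lucasV t d 2) (d\<^sup>2) (\<lambda>n. lucasV t d (0 + n * 2))"
    by (rule binary_recurrence_subsequence[OF binary_recurrence_lucasV])
  ultimately obtain m where "m > 0" "[lucasV t d (m * 2) = 2] (mod q)"
    using binary_recurrence_returns_mod[OF _ _ q,
        of "lucasV t d 2" "d\<^sup>2" "\<lambda>n. lucasV t d (0 + n * 2)"] by auto
  moreover have "d ^ (m * 2) = 1" using \<open>d\<^sup>2 = 1\<close> by (simp add: mult.commute[of m] power_mult)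
  ultimately show ?thesis by (intro that[of "m * 2"]) auto
qed

section \<open>Recurrences over the \<open>p\<close>-adic numbers\<close>

lemma binary_recurrence_near_linear:
  fixes g :: "nat \<Rightarrow> 'p::prime_card padic"
  assumes g: "binary_recurrence t d g"
    and t: "padic_abs (t - 2) \<le> e" and d: "padic_abs (d - 1) \<le> e" and e: "e \<le> 1"
    and g01: "padic_abs (g 0) \<le> 1" "padic_abs (g 1) \<le> 1"
  shows "padic_abs (g n - (g 0 + of_nat n * (g 1 - g 0))) \<le> e"
proof -
  have two: "padic_abs (2 :: 'p padic) \<le> 1" using padic_abs_of_nat_le_1[of 2, where 'p='p] by simp
  have integral: "padic_abs t \<le> 1" "padic_abs d \<le> 1"
    using t d e padic_abs_le_1_of_near_int[of t 2] padic_abs_le_1_of_near_int[of d 1] by simp_all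
  have "padic_abs (g n) \<le> 1 \<and> padic_abs (g (n + 1)) \<le> 1" for n
    using g01 binary_recurrenceD[OF g]
    by (induction n) (auto intro!: padic_abs_diff_le padic_abs_integral_mult_le integral)
  hence bound: "padic_abs (g n) \<le> 1" for n by blast
  define h where "h n = g n - (g 0 + of_nat n * (g 1 - g 0))" for n
  have h_rec: "h (n + 2) = (g (n + 1) * (t - 2) - g n * (d - 1)) + (2 * h (n + 1) - h n)" for n
    unfolding h_def binary_recurrenceD[OF g] by (simp add: algebra_simps)
  have "padic_abs (h n) \<le> e \<and> padic_abs (h (n + 1)) \<le> e" for n
  proof (induction n)
    case 0
    have "e \<ge> 0" using t padic_abs_nonneg[of "t - 2"] by linarith
    thus ?case by (simp add: h_def)
  next
    case (Suc n)
    have "padic_abs (h (n + 2)) \<le> e"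
      unfolding h_rec
      by (intro padic_abs_add_le padic_abs_diff_le padic_abs_integral_mult_le bound t d two)
        (use Suc in auto)
    thus ?case using Suc by simp
  qed
  thus ?thesis unfolding h_def by blast
qed

lemma lucasV_near_2:
  fixes t d :: "'p::prime_card padic"
  assumes t: "padic_abs (t - 2) \<le> e" and d: "padic_abs (d - 1) \<le> e" and e: "e \<le> 1"
  shows "padic_abs (lucasV t d n - 2) \<le> e"
proof -
  have "padic_abs (2 :: 'p padic) \<le> 1" using padic_abs_of_nat_le_1[of 2, where 'p='p] by simp
  moreover have "padic_abs t \<le> 1" using t e padic_abs_le_1_of_near_int[of t 2] by simp
  ultimately have "padic_abs (lucasV t d n - (2 + of_nat n * (t - 2))) \<le> e"
    using binary_recurrence_near_linear[OF binary_recurrence_lucasV t d e, of n] by simp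
  moreover have "padic_abs (of_nat n * (t - 2)) \<le> e"
    by (intro padic_abs_integral_mult_le padic_abs_of_nat_le_1 t)
  ultimately have "padic_abs (lucasV t d n - (2 + of_nat n * (t - 2)) + of_nat n * (t - 2)) \<le> e"
    by (rule padic_abs_add_le)
  thus ?thesis by (simp add: algebra_simps)
qed

lemma power_near_1:
  fixes d :: "'p::prime_card padic"
  assumes d: "padic_abs (d - 1) \<le> e" and e: "e \<le> 1"
  shows "padic_abs (d ^ n - 1) \<le> e"
proof (induction n)
  case 0
  thus ?case using d padic_abs_nonneg[of "d - 1"] by simp
next
  case (Suc n)
  have "padic_abs d \<le> 1" using d e padic_abs_le_1_of_near_int[of d 1] by simp
  hence "padic_abs (d * (d ^ n - 1) + (d - 1)) \<le> e"
    using Suc d by (intro padic_abs_add_le padic_abs_integral_mult_le) auto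
  thus ?case by (simp add: algebra_simps)
qed

lemma binary_recurrence_multiples_of_prime:
  fixes g :: "nat \<Rightarrow> 'p::prime_card padic"
  assumes g: "binary_recurrence t d g"
    and t: "padic_abs (t - 2) \<le> 1 / real CARD('p) ^ 2"
    and d: "padic_abs (d - 1) \<le> 1 / real CARD('p) ^ 2"
    and g0: "padic_abs (g 0) \<le> 1 / real CARD('p)" and g1: "padic_abs (g 1) = 1"
  shows "\<exists>j. \<forall>m. padic_abs (g (j * CARD('p) + m * CARD('p)) - of_nat m * (of_nat CARD('p) * g 1))
    \<le> 1 / real CARD('p) ^ 2"
proof -
  let ?p = "CARD('p)" and ?P = "of_nat CARD('p) :: 'p padic"
  let ?e = "1 / real ?p ^ 2"
  have p: "real ?p > 1" using nontriv[where 'a='p] by simp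
  have "1 / real ?p \<le> 1" using p by simp
  hence lin: "padic_abs (g n - (g 0 + of_nat n * (g 1 - g 0))) \<le> ?e" for n
    using p by (intro binary_recurrence_near_linear[OF g t d _ order_trans[OF g0]])
      (auto simp: g1[simplified])
  have g1_nz: "g 1 \<noteq> 0" using g1 by auto
  define x where "x = - g 0 / (?P * g 1)"
  have "padic_abs x \<le> 1"
    using g0 p by (simp add: x_def padic_abs_divide padic_abs_mult padic_abs_prime
        g1[simplified] field_simps)
  then obtain j where j: "padic_abs (x - of_nat j) < 1 / real ?p"
    using padic_nat_dense[of x "1 / real ?p"] p by auto
  have "padic_abs (g (j * ?p + m * ?p) - of_nat m * (?P * g 1)) \<le> ?e" for m
  proof -
    let ?n = "j * ?p + m * ?p"
    have "g 0 = - (?P * g 1 * x)" using g1_nz by (simp add: x_def)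
    hence decomposition: "g ?n - of_nat m * (?P * g 1) = (g ?n - (g 0 + of_nat ?n * (g 1 - g 0)))
       - ?P * (x - of_nat j) * g 1 - of_nat (j + m) * (?P * g 0)"
      by (simp add: algebra_simps)
    have "padic_abs (?P * (x - of_nat j) * g 1) \<le> 1 / real ?p * (1 / real ?p) * 1"
      using j g1 by (intro padic_abs_mult_le) (auto simp: padic_abs_prime)
    hence correction: "padic_abs (?P * (x - of_nat j) * g 1) \<le> ?e"
      by (simp add: power2_eq_square)
    have "padic_abs (?P * g 0) \<le> ?e"
      using padic_abs_mult_le[OF eq_refl[OF padic_abs_prime] g0] by (simp add: power2_eq_square)
    hence "padic_abs (of_nat (j + m) * (?P * g 0)) \<le> ?e"
      by (rule padic_abs_integral_mult_le[OF padic_abs_of_nat_le_1])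
    thus ?thesis unfolding decomposition by (intro padic_abs_diff_le lin correction)
  qed
  thus ?thesis by blast
qed

text \<open>Modulo \<open>p\<^sup>2\<close> the sequence is an arithmetic progression with unit difference, so some
  \<open>g (j * p)\<close> is divisible by \<open>p\<^sup>2\<close>. The sequence \<open>m \<mapsto> g (j * p + m * p) / p\<close> then satisfies
  the same hypotheses.\<close>

lemma binary_recurrence_small_value:
  fixes g :: "nat \<Rightarrow> 'p::prime_card padic"
  assumes "binary_recurrence t d g"
    and "padic_abs (t - 2) \<le> 1 / real CARD('p) ^ 2" and "padic_abs (d - 1) \<le> 1 / real CARD('p) ^ 2"
    and "padic_abs (g 0) \<le> 1 / real CARD('p)" and "padic_abs (g 1) = 1"
  shows "\<exists>n. padic_abs (g n) \<le> 1 / real CARD('p) ^ k"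
  using assms
proof (induction k arbitrary: g t d)
  case 0
  thus ?case by (auto intro!: exI[of _ 1])
next
  case (Suc k)
  note g = Suc.prems(1) and near = Suc.prems(2,3) and g1 = Suc.prems(5)
  let ?p = "CARD('p)" and ?P = "of_nat CARD('p) :: 'p padic"
  have p: "real ?p > 1" using nontriv[where 'a='p] by simp
  hence e: "1 / real ?p ^ 2 < 1 / real ?p" "1 / real ?p \<le> 1"
    by (simp_all add: power2_eq_square field_simps)
  hence e_le_1: "1 / real ?p ^ 2 \<le> 1" by linarith
  obtain j where j: "\<And>m. padic_abs (g (j * ?p + m * ?p) - of_nat m * (?P * g 1)) \<le> 1 / real ?p ^ 2"
    using binary_recurrence_multiples_of_prime[OF Suc.prems] by blast
  define g' where "g' m = g (j * ?p + m * ?p) / ?P" for m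
  have "\<exists>n. padic_abs (g' n) \<le> 1 / real ?p ^ k"
  proof (rule Suc.IH)
    show "binary_recurrence (lucasV t d ?p) (d ^ ?p) g'"
      unfolding g'_def by (intro binary_recurrence_divide binary_recurrence_subsequence g)
    show "padic_abs (lucasV t d ?p - 2) \<le> 1 / real ?p ^ 2" by (rule lucasV_near_2[OF near e_le_1])
    show "padic_abs (d ^ ?p - 1) \<le> 1 / real ?p ^ 2" by (rule power_near_1[OF near(2) e_le_1])
    show "padic_abs (g' 0) \<le> 1 / real ?p"
      using j[of 0] p
      by (simp add: g'_def padic_abs_divide padic_abs_prime field_simps power2_eq_square)
    have P_g1: "padic_abs (?P * g 1) = 1 / real ?p"
      by (simp only: padic_abs_mult padic_abs_prime g1 mult_1_right)
    hence "padic_abs (g (j * ?p + 1 * ?p)) = padic_abs (?P * g 1)"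
      using j[of 1] e(1) by (intro padic_abs_eq_of_diff_less) simp
    thus "padic_abs (g' 1) = 1"
      using p by (simp add: g'_def padic_abs_divide padic_abs_prime P_g1[simplified])
  qed
  then obtain n where "padic_abs (g' n) \<le> 1 / real ?p ^ k" ..
  hence "padic_abs (g (j * ?p + n * ?p)) \<le> 1 / real ?p ^ Suc k"
    using p by (simp add: g'_def padic_abs_divide padic_abs_prime field_simps)
  thus ?case ..
qed

lemma lucasV_returns_padic:
  fixes t d :: int
  assumes d: "\<bar>d\<bar> = 1"
  obtains m where "m > 0" "(of_int d :: 'p::prime_card padic) ^ m = 1"
    "padic_abs (lucasV (of_int t) (of_int d) m - 2 :: 'p padic) \<le> 1 / real CARD('p) ^ k"
proof -
  obtain m where m: "m > 0" "[lucasV t d m = 2] (mod int CARD('p) ^ k)" "d ^ m = 1"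
    using lucasV_returns_mod[OF d, of "int CARD('p) ^ k" t] by auto
  have "padic_abs (of_int (lucasV t d m - 2) :: 'p padic) \<le> 1 / real CARD('p) ^ k"
    using m(2) by (simp only: padic_abs_of_int_le_iff cong_iff_dvd_diff)
  moreover have "(of_int d :: 'p padic) ^ m = 1" using m(3) by (metis of_int_1 of_int_power)
  ultimately show ?thesis using m(1) by (intro that) (simp_all add: of_int_lucasV)
qed

lemma binary_recurrence_approaches_0:
  fixes t d :: int
  assumes d: "\<bar>d\<bar> = 1"
  shows "\<exists>m>0. \<forall>f :: nat \<Rightarrow> 'p::prime_card padic. binary_recurrence (of_int t) (of_int d) f \<longrightarrow>
    padic_abs (f 0) \<le> padic_abs (f m) / real CARD('p) \<longrightarrow> (\<forall>e>0. \<exists>n. padic_abs (f n) < e)"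
proof -
  obtain m where m: "m > 0" and d_m: "(of_int d :: 'p padic) ^ m = 1"
    and V: "padic_abs (lucasV (of_int t) (of_int d) m - 2 :: 'p padic) \<le> 1 / real CARD('p) ^ 2"
    using lucasV_returns_padic[OF d] by blast
  have "\<exists>n. padic_abs (f n) < e"
    if f: "binary_recurrence (of_int t) (of_int d) f"
      and f0: "padic_abs (f 0) \<le> padic_abs (f m) / real CARD('p)" and e: "e > 0"
    for f :: "nat \<Rightarrow> 'p padic" and e
  proof (cases "f m = 0")
    case True
    thus ?thesis using e by (intro exI[of _ m]) simp
  next
    case False
    hence fm: "padic_abs (f m) > 0" by (simp add: padic_abs_pos_iff)
    obtain k where k: "1 / real CARD('p) ^ k < e / padic_abs (f m)"
      using prime_power_inverse_less[of "e / padic_abs (f m)"] e fm by auto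
    let ?g = "\<lambda>n. f (0 + n * m) / f m"
    have "binary_recurrence (lucasV (of_int t) (of_int d) m) (of_int d ^ m) ?g"
      by (intro binary_recurrence_divide binary_recurrence_subsequence f)
    hence "\<exists>n. padic_abs (?g n) \<le> 1 / real CARD('p) ^ k"
      by (rule binary_recurrence_small_value[OF _ V])
        (use fm f0 in \<open>auto simp: d_m padic_abs_divide field_simps\<close>)
    then obtain n where "padic_abs (?g n) < e / padic_abs (f m)"
      using k by (auto intro: le_less_trans)
    hence "padic_abs (f (n * m)) < e" using fm by (simp add: padic_abs_divide divide_less_cancel)
    thus ?thesis ..
  qed
  thus ?thesis using m by blast
qed

section \<open>Plane vectors and hyperbolic matrices\<close>

definition wedge :: "'a::comm_ring_1 ^ 2 \<Rightarrow> 'a ^ 2 \<Rightarrow> 'a" where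
  "wedge u v = u $ 1 * v $ 2 - u $ 2 * v $ 1"

definition of_int_vec :: "int ^ 'n \<Rightarrow> 'a::ring_1 ^ 'n" where
  "of_int_vec r = (\<chi> i. of_int (r $ i))"

abbreviation of_int_mat :: "int ^ 'n ^ 'm \<Rightarrow> 'a::ring_1 ^ 'n ^ 'm" where
  "of_int_mat \<equiv> map_matrix of_int"

lemma of_int_vec_nth [simp]: "of_int_vec r $ i = of_int (r $ i)"
  by (simp add: of_int_vec_def)

lemma of_int_vec_matrix_vector_mult: "of_int_vec (M *v r) = of_int_mat M *v of_int_vec r"
  by (simp add: vec_eq_iff matrix_vector_mult_def)

lemma of_int_mat_matrix_matrix_mult: "of_int_mat (M ** M') = of_int_mat M ** of_int_mat M'"
  by (simp add: vec_eq_iff matrix_matrix_mult_def)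

lemma of_int_mat_1: "of_int_mat (mat 1) = mat 1"
  by (simp add: vec_eq_iff mat_def)

lemma trace_of_int_mat: "trace (of_int_mat M) = of_int (trace M)"
  by (simp add: trace_def)

lemma det_of_int_mat: "det (of_int_mat M) = of_int (det M)"
  by (simp add: det_def)

lemma wedge_self [simp]: "wedge v v = 0"
  by (simp add: wedge_def)

lemma wedge_diff_left: "wedge (u - v) w = wedge u w - wedge v w"
  by (simp add: wedge_def algebra_simps)

lemma wedge_scale_right: "wedge u (c *s v) = c * wedge u v"
  by (simp add: wedge_def algebra_simps)

lemma of_int_wedge: "of_int (wedge r s) = wedge (of_int_vec r) (of_int_vec s)"
  by (simp add: wedge_def)

lemma wedge_scale_cramer: "wedge r s *s v = wedge v s *s r + wedge r v *s s"
  by (simp add: wedge_def vec_eq_iff forall_2 algebra_simps)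

lemma wedge_matrix_mult: "wedge (A *v u) (A *v v) = det A * wedge u v"
  by (simp add: wedge_def matrix_vector_mult_def sum_2 det_2 algebra_simps)

lemma wedge_eq_0_iff:
  fixes u v :: "'a::field ^ 2"
  assumes "u \<noteq> 0"
  shows "wedge u v = 0 \<longleftrightarrow> (\<exists>c. v = c *s u)"
proof
  assume uv: "wedge u v = 0"
  show "\<exists>c. v = c *s u"
  proof (cases "u $ 1 = 0")
    case True
    hence "u $ 2 \<noteq> 0" using assms by (auto simp: vec_eq_iff forall_2)
    thus ?thesis using uv True
      by (intro exI[of _ "v $ 2 / u $ 2"]) (simp add: wedge_def vec_eq_iff forall_2)
  next
    case False
    thus ?thesis using uv
      by (intro exI[of _ "v $ 1 / u $ 1"]) (simp add: wedge_def vec_eq_iff forall_2 field_simps)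
  qed
qed (auto simp: wedge_scale_right)

lemma is_eigenvector_iff_wedge:
  fixes A :: "'a::field ^ 2 ^ 2"
  shows "is_eigenvector A v \<longleftrightarrow> v \<noteq> 0 \<and> wedge v (A *v v) = 0"
  unfolding is_eigenvector_def using wedge_eq_0_iff by blast

lemma cayley_hamilton_2:
  fixes A :: "'a::comm_ring_1 ^ 2 ^ 2"
  shows "A *v (A *v v) = trace A *s (A *v v) - det A *s v"
  by (simp add: vec_eq_iff forall_2 matrix_vector_mult_def sum_2 trace_def det_2 algebra_simps)

lemma binary_recurrence_wedge_orbit:
  "binary_recurrence (trace A) (det A) (\<lambda>n. wedge u (((*v) A ^^ n) v))"
  unfolding binary_recurrence_def
proof
  fix n
  let ?y = "((*v) A ^^ n) v"
  have "wedge u (A *v (A *v ?y)) = trace A * wedge u (A *v ?y) - det A * wedge u ?y"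
    unfolding cayley_hamilton_2 by (simp add: wedge_def algebra_simps)
  thus "wedge u (((*v) A ^^ (n + 2)) v)
      = trace A * wedge u (((*v) A ^^ (n + 1)) v) - det A * wedge u ?y" by simp
qed

text \<open>An integer matrix of determinant \<open>\<plusminus>1\<close> is hyperbolic if its eigenvalues are real and of
  distinct absolute values.\<close>

definition hyperbolic :: "int ^ 2 ^ 2 \<Rightarrow> bool" where
  "hyperbolic M \<longleftrightarrow> \<bar>det M\<bar> = 1 \<and> trace M \<noteq> 0 \<and> 4 * det M < (trace M)\<^sup>2"

lemma hyperbolic_discriminant_not_square:
  assumes "hyperbolic M"
  shows "(trace M)\<^sup>2 - 4 * det M \<noteq> k\<^sup>2"
proof
  define t d where "t = trace M" and "d = det M"
  have M: "\<bar>d\<bar> = 1" "t \<noteq> 0" "4 * d < t\<^sup>2"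
    using assms by (simp_all add: hyperbolic_def t_def d_def)
  assume "(trace M)\<^sup>2 - 4 * det M = k\<^sup>2"
  hence square: "t\<^sup>2 - 4 * d = k\<^sup>2" by (simp add: t_def d_def)
  have "even (t\<^sup>2 - 4 * d) \<longleftrightarrow> even t" by simp
  hence "even (k - t)" unfolding square by auto
  then obtain i where i: "k = t + 2 * i" by (metis add.commute diff_add_cancel evenE)
  hence "i * (t + i) = - d" using square by (simp add: power2_eq_square algebra_simps)
  hence "\<bar>i * (t + i)\<bar> = 1" using M(1) by simp
  hence "\<bar>i\<bar> = 1" "\<bar>t + i\<bar> = 1" using abs_zmult_eq_1 by (blast, metis abs_zmult_eq_1 mult.commute)
  hence "k = 0" using i M(2) by linarith
  thus False using square M(3) by simp
qed

lemma anisotropic_of_discriminant_not_square: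
  fixes A B C a b :: int
  assumes disc: "\<And>k. B\<^sup>2 - 4 * A * C \<noteq> k\<^sup>2"
    and zero: "A * a\<^sup>2 + B * a * b + C * b\<^sup>2 = 0"
  shows "a = 0 \<and> b = 0"
proof -
  have "(2 * A * a + B * b)\<^sup>2 = 4 * A * (A * a\<^sup>2 + B * a * b + C * b\<^sup>2) + (B\<^sup>2 - 4 * A * C) * b\<^sup>2"
    by (simp add: algebra_simps power2_eq_square)
  hence square: "(2 * A * a + B * b)\<^sup>2 = (B\<^sup>2 - 4 * A * C) * b\<^sup>2" using zero by simp
  hence "b\<^sup>2 dvd (2 * A * a + B * b)\<^sup>2" by simp
  hence "b dvd 2 * A * a + B * b" by (simp only: pow_divides_pow_iff zero_less_numeral)
  then obtain k where "2 * A * a + B * b = b * k" by blast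
  with square have "(B\<^sup>2 - 4 * A * C) * b\<^sup>2 = k\<^sup>2 * b\<^sup>2"
    by (simp only: power_mult_distrib mult.commute)
  hence "b = 0" using disc[of k] by simp
  moreover have "A \<noteq> 0" using disc[of B] by auto
  ultimately show ?thesis using zero by simp
qed

lemma hyperbolic_wedge_nonzero:
  assumes "hyperbolic M" and "r \<noteq> 0"
  shows "wedge r (M *v r) \<noteq> 0"
proof
  let ?A = "M $ 2 $ 1" and ?B = "M $ 2 $ 2 - M $ 1 $ 1" and ?C = "- (M $ 1 $ 2)"
  assume "wedge r (M *v r) = 0"
  hence "?A * (r $ 1)\<^sup>2 + ?B * r $ 1 * r $ 2 + ?C * (r $ 2)\<^sup>2 = 0"
    by (simp add: wedge_def matrix_vector_mult_def sum_2 power2_eq_square algebra_simps)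
  moreover have "?B\<^sup>2 - 4 * ?A * ?C = (trace M)\<^sup>2 - 4 * det M"
    by (simp add: trace_def det_2 sum_2 power2_eq_square algebra_simps)
  ultimately have "r $ 1 = 0 \<and> r $ 2 = 0"
    using hyperbolic_discriminant_not_square[OF assms(1)]
    by (intro anisotropic_of_discriminant_not_square[of ?B ?A ?C]) auto
  thus False using assms(2) by (simp add: vec_eq_iff forall_2)
qed

section \<open>The maximum norm on \<open>p\<close>-adic vectors\<close>

definition padic_norm :: "'p::prime_card padic ^ 'n \<Rightarrow> real" where
  "padic_norm v = (MAX i. padic_abs (v $ i))"

lemma padic_norm_2:
  fixes v :: "'p::prime_card padic ^ 2"
  shows "padic_norm v = max (padic_abs (v $ 1)) (padic_abs (v $ 2))"
  by (simp add: padic_norm_def UNIV_2)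

lemma padic_norm_le_iff: "padic_norm v \<le> e \<longleftrightarrow> (\<forall>i. padic_abs (v $ i) \<le> e)"
  by (simp add: padic_norm_def)

lemma padic_norm_less_iff: "padic_norm v < e \<longleftrightarrow> (\<forall>i. padic_abs (v $ i) < e)"
  by (simp add: padic_norm_def)

lemma padic_abs_nth_le_norm: "padic_abs (v $ i) \<le> padic_norm v"
  by (simp add: padic_norm_def)

lemma padic_norm_eq_abs_nth: "\<exists>i. padic_norm v = padic_abs (v $ i)"
proof -
  have "padic_norm v \<in> range (\<lambda>i. padic_abs (v $ i))"
    unfolding padic_norm_def by (rule Max_in) auto
  thus ?thesis by blast
qed

lemma padic_norm_nonneg: "padic_norm v \<ge> 0"
  using padic_norm_eq_abs_nth[of v] padic_abs_nonneg by metis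

lemma padic_norm_pos_iff: "padic_norm v > 0 \<longleftrightarrow> v \<noteq> 0"
  by (simp add: padic_norm_def Max_gr_iff vec_eq_iff padic_abs_pos_iff)

lemma padic_norm_scale: "padic_norm (c *s v) = padic_abs c * padic_norm v"
proof (rule antisym)
  show "padic_norm (c *s v) \<le> padic_abs c * padic_norm v"
    by (simp add: padic_norm_le_iff padic_abs_mult_le padic_abs_nth_le_norm)
  obtain i where "padic_norm v = padic_abs (v $ i)" using padic_norm_eq_abs_nth ..
  thus "padic_abs c * padic_norm v \<le> padic_norm (c *s v)"
    using padic_abs_nth_le_norm[of "c *s v" i] by (simp add: padic_abs_mult)
qed

lemma padic_norm_add_le: "padic_norm u \<le> e \<Longrightarrow> padic_norm v \<le> e \<Longrightarrow> padic_norm (u + v) \<le> e"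
  by (simp add: padic_norm_le_iff padic_abs_add_le)

lemma padic_norm_diff_le: "padic_norm u \<le> e \<Longrightarrow> padic_norm v \<le> e \<Longrightarrow> padic_norm (u - v) \<le> e"
  by (simp add: padic_norm_le_iff padic_abs_diff_le)

lemma padic_norm_integral_scale_le:
  "padic_abs c \<le> 1 \<Longrightarrow> padic_norm v \<le> e \<Longrightarrow> padic_norm (c *s v) \<le> e"
  by (simp add: padic_norm_le_iff padic_abs_integral_mult_le)

lemma padic_norm_of_int_vec_le_1: "padic_norm (of_int_vec r :: 'p::prime_card padic ^ 'n) \<le> 1"
  by (simp add: padic_norm_le_iff padic_abs_of_int_le_1)

lemma padic_norm_of_int_mat_mult_le: "padic_norm (of_int_mat M *v v) \<le> padic_norm v"
  unfolding padic_norm_le_iff matrix_vector_mult_def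
  by (auto intro!: padic_abs_sum_le padic_abs_integral_mult_le padic_abs_of_int_le_1
      padic_abs_nth_le_norm padic_norm_nonneg)

lemma padic_int_vector_dense:
  fixes v :: "'p::prime_card padic ^ 'n"
  assumes "padic_norm v \<le> 1" and "e > 0"
  shows "\<exists>r. padic_norm (v - of_int_vec r) < e"
proof -
  have "\<exists>j::nat. padic_abs (v $ i - of_nat j) < e" for i
    using assms by (intro padic_nat_dense) (auto simp: padic_norm_le_iff)
  then obtain j :: "'n \<Rightarrow> nat" where "padic_abs (v $ i - of_nat (j i)) < e" for i by metis
  thus ?thesis by (intro exI[of _ "\<chi> i. int (j i)"]) (simp add: padic_norm_less_iff)
qed

section \<open>Orbits of hyperbolic matrices\<close>

lemma padic_abs_wedge_le: "padic_abs (wedge u v) \<le> padic_norm u * padic_norm v"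
  unfolding wedge_def by (intro padic_abs_diff_le padic_abs_mult_le padic_abs_nth_le_norm)

lemma padic_norm_unimodular_mult:
  fixes v :: "'p::prime_card padic ^ 2"
  assumes "\<bar>det M\<bar> = 1"
  shows "padic_norm (of_int_mat M *v v) = padic_norm v"
proof (rule antisym)
  let ?B = "of_int_mat M :: 'p padic ^ 2 ^ 2"
  have "padic_norm v = padic_norm (of_int (det M) *s v)"
    by (simp add: padic_norm_scale padic_abs_of_int_unit[OF assms])
  also have "of_int (det M) *s v = of_int (trace M) *s (?B *v v) - ?B *v (?B *v v)"
    using cayley_hamilton_2[of ?B v] by (simp add: det_of_int_mat trace_of_int_mat)
  also have "padic_norm \<dots> \<le> padic_norm (?B *v v)"
    by (intro padic_norm_diff_le padic_norm_integral_scale_le padic_norm_of_int_mat_mult_le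
        padic_abs_of_int_le_1 order_refl)
  finally show "padic_norm v \<le> padic_norm (?B *v v)" .
qed (rule padic_norm_of_int_mat_mult_le)

lemma padic_norm_unimodular_orbit:
  fixes v :: "'p::prime_card padic ^ 2"
  assumes "\<bar>det M\<bar> = 1"
  shows "padic_norm (((*v) (of_int_mat M) ^^ n) v) = padic_norm v"
  by (induction n) (simp_all add: padic_norm_unimodular_mult[OF assms])

lemma wedge_hyperbolic_orbit_nonzero:
  fixes v :: "'a::field_char_0 ^ 2"
  assumes M: "hyperbolic M" and v: "wedge v (of_int_mat M *v v) \<noteq> 0" and n: "n > 0"
  shows "wedge v (((*v) (of_int_mat M) ^^ n) v) \<noteq> 0"
proof -
  let ?y = "\<lambda>n. ((*v) (of_int_mat M) ^^ n) v"
  have "wedge v (?y n) = of_int (lucasU (trace M) (det M) n) * wedge v (?y 1)"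
    using binary_recurrence_eq_lucasU[OF binary_recurrence_wedge_orbit, of v "of_int_mat M" v n]
    by (simp add: of_int_lucasU trace_of_int_mat det_of_int_mat)
  thus ?thesis using v lucasU_nonzero[of "det M" "trace M" n] M n by (simp add: hyperbolic_def)
qed

lemma hyperbolic_wedge_orbit_approaches_0:
  fixes v :: "'p::prime_card padic ^ 2"
  assumes "hyperbolic M"
  defines "y \<equiv> \<lambda>n. ((*v) (of_int_mat M) ^^ n) v"
  shows "\<exists>m>0. \<forall>u. padic_abs (wedge u v) \<le> padic_abs (wedge u (y m)) / real CARD('p) \<longrightarrow>
    (\<forall>e>0. \<exists>n. padic_abs (wedge u (y n)) < e)"
proof -
  have recurrence: "binary_recurrence (of_int (trace M)) (of_int (det M)) (\<lambda>n. wedge u (y n))" for u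
    unfolding y_def using binary_recurrence_wedge_orbit[of "of_int_mat M"]
    by (simp only: trace_of_int_mat det_of_int_mat)
  have "\<bar>det M\<bar> = 1" using assms(1) by (simp add: hyperbolic_def)
  from binary_recurrence_approaches_0[OF this, of "trace M", where 'p = 'p]
  obtain m where m: "m > 0" and approach:
    "\<forall>f :: nat \<Rightarrow> 'p padic. binary_recurrence (of_int (trace M)) (of_int (det M)) f \<longrightarrow>
      padic_abs (f 0) \<le> padic_abs (f m) / real CARD('p) \<longrightarrow> (\<forall>e>0. \<exists>n. padic_abs (f n) < e)"
    by blast
  have "padic_abs (wedge u v) \<le> padic_abs (wedge u (y m)) / real CARD('p) \<longrightarrow>
      (\<forall>e>0. \<exists>n. padic_abs (wedge u (y n)) < e)" for u
    using approach[rule_format, OF recurrence, of u] by (simp add: y_def)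
  thus ?thesis using m by blast
qed

text \<open>Take \<open>r\<close> so close to \<open>v\<close> that \<open>n \<mapsto> wedge r (M\<^sup>n v)\<close> starts at a value that is small
  compared with its value at some \<open>m\<close> at which the recurrence has returned modulo \<open>p\<^sup>2\<close>.\<close>

lemma hyperbolic_orbit_approaches_rational:
  fixes v :: "'p::prime_card padic ^ 2"
  assumes M: "hyperbolic M" and v: "padic_norm v = 1" and indep: "wedge v (of_int_mat M *v v) \<noteq> 0"
  shows "\<exists>r. r \<noteq> 0 \<and>
    (\<forall>e>0. \<exists>n. padic_abs (wedge (of_int_vec r) (((*v) (of_int_mat M) ^^ n) v)) < e)"
proof -
  define y where "y n = ((*v) (of_int_mat M) ^^ n) v" for n
  obtain m where m: "m > 0" and approach:
    "\<And>u. padic_abs (wedge u v) \<le> padic_abs (wedge u (y m)) / real CARD('p) \<Longrightarrow>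
      \<forall>e>0. \<exists>n. padic_abs (wedge u (y n)) < e"
    using hyperbolic_wedge_orbit_approaches_0[OF M, of v] unfolding y_def by blast
  have pos: "padic_abs (wedge v (y m)) > 0"
    unfolding y_def padic_abs_pos_iff by (rule wedge_hyperbolic_orbit_nonzero[OF M indep m])
  define e where "e = padic_abs (wedge v (y m)) / real CARD('p)"
  have norm_y: "padic_norm (y n) = 1" for n
    unfolding y_def using v M by (simp add: padic_norm_unimodular_orbit hyperbolic_def)
  have e: "0 < e" "e < padic_abs (wedge v (y m))" "e < 1"
  proof -
    show "0 < e" "e < padic_abs (wedge v (y m))"
      using pos nontriv[where 'a='p] by (simp_all add: e_def divide_less_eq)
    thus "e < 1" using padic_abs_wedge_le[of v "y m"] by (simp add: v norm_y)
  qed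
  obtain r where r: "padic_norm (v - of_int_vec r) < e"
    using padic_int_vector_dense[of v e] v e by auto
  let ?g = "\<lambda>n. wedge (of_int_vec r) (y n)"
  have close: "padic_abs (wedge v (y n) - ?g n) < e" for n
    using padic_abs_wedge_le[of "v - of_int_vec r" "y n"] r by (simp add: wedge_diff_left norm_y)
  have "padic_abs (?g m) = padic_abs (wedge v (y m))"
    using close[of m] e(2) by (intro padic_abs_eq_of_diff_less) (simp add: padic_abs_minus_commute)
  moreover have "padic_abs (wedge (of_int_vec r) v) \<le> e" using close[of 0] by (simp add: y_def)
  ultimately have "\<forall>e>0. \<exists>n. padic_abs (?g n) < e" using approach by (simp add: e_def)
  moreover have "r \<noteq> 0"
  proof
    assume "r = 0"
    hence "v - of_int_vec r = v" by (simp add: vec_eq_iff)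
    thus False using r v e(3) by simp
  qed
  ultimately show ?thesis unfolding y_def by blast
qed

section \<open>Badly approximable points\<close>

definition height :: "int ^ 2 \<Rightarrow> int" where
  "height r = max \<bar>r $ 1\<bar> \<bar>r $ 2\<bar>"

lemma height_eq_0_iff: "height r = 0 \<longleftrightarrow> r = 0"
  by (auto simp: height_def vec_eq_iff forall_2)

lemma height_power2:
  "real_of_int (height r) ^ 2 = max (real_of_int (r $ 1) ^ 2) (real_of_int (r $ 2) ^ 2)"
proof (cases "\<bar>r $ 1\<bar> \<le> \<bar>r $ 2\<bar>")
  case True
  hence "real_of_int (r $ 1) ^ 2 \<le> real_of_int (r $ 2) ^ 2" by (simp flip: abs_le_square_iff)
  thus ?thesis using True by (simp add: height_def)
next
  case False
  hence "real_of_int (r $ 2) ^ 2 \<le> real_of_int (r $ 1) ^ 2" by (simp flip: abs_le_square_iff)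
  thus ?thesis using False by (simp add: height_def max_def)
qed

lemma abs_wedge_matrix_mult_le:
  "\<bar>wedge r (M *v r)\<bar> \<le> (\<Sum>i\<in>UNIV. \<Sum>j\<in>UNIV. \<bar>M $ i $ j\<bar>) * (height r)\<^sup>2"
proof -
  have bound: "\<bar>M $ k $ l * (r $ i * r $ j)\<bar> \<le> \<bar>M $ k $ l\<bar> * (height r)\<^sup>2" for i j k l :: 2
  proof -
    have "\<bar>r $ i\<bar> \<le> height r" for i
      using exhaust_2[of i] by (auto simp: height_def)
    hence "\<bar>r $ i\<bar> * \<bar>r $ j\<bar> \<le> height r * height r"
      by (intro mult_mono) (auto intro: order_trans[OF abs_ge_zero])
    thus ?thesis by (simp add: abs_mult power2_eq_square mult_left_mono)
  qed
  have "wedge r (M *v r) = M $ 2 $ 1 * (r $ 1 * r $ 1) + M $ 2 $ 2 * (r $ 1 * r $ 2)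
      - M $ 1 $ 1 * (r $ 1 * r $ 2) - M $ 1 $ 2 * (r $ 2 * r $ 2)"
    by (simp add: wedge_def matrix_vector_mult_def sum_2 algebra_simps)
  hence "\<bar>wedge r (M *v r)\<bar> \<le> \<bar>M $ 2 $ 1 * (r $ 1 * r $ 1)\<bar> + \<bar>M $ 2 $ 2 * (r $ 1 * r $ 2)\<bar>
      + \<bar>M $ 1 $ 1 * (r $ 1 * r $ 2)\<bar> + \<bar>M $ 1 $ 2 * (r $ 2 * r $ 2)\<bar>"
    by linarith
  also have "\<dots> \<le> \<bar>M $ 2 $ 1\<bar> * (height r)\<^sup>2 + \<bar>M $ 2 $ 2\<bar> * (height r)\<^sup>2
      + \<bar>M $ 1 $ 1\<bar> * (height r)\<^sup>2 + \<bar>M $ 1 $ 2\<bar> * (height r)\<^sup>2"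
    by (intro add_mono bound)
  also have "\<dots> = (\<Sum>i\<in>UNIV. \<Sum>j\<in>UNIV. \<bar>M $ i $ j\<bar>) * (height r)\<^sup>2"
    by (simp add: sum_2 distrib_right)
  finally show ?thesis .
qed

lemma abs_proj_line_eq_iff:
  assumes "u \<noteq> 0" and "v \<noteq> 0"
  shows "abs_proj_line u = abs_proj_line v \<longleftrightarrow> wedge u v = 0"
proof -
  have refl: "proj_rel w w" if "w \<noteq> 0" for w :: "'a ^ 2"
    using that by (auto simp: proj_rel_def intro!: exI[of _ 1])
  have "abs_proj_line u = abs_proj_line v \<longleftrightarrow> proj_rel u v"
    using Quotient_rel[OF Quotient_proj_line] refl[OF assms(1)] refl[OF assms(2)] by blast
  also have "\<dots> \<longleftrightarrow> (\<exists>c. v = c *s u)"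
    using assms by (auto simp: proj_rel_def)
  also have "\<dots> \<longleftrightarrow> wedge u v = 0" by (rule wedge_eq_0_iff[OF assms(1), symmetric])
  finally show ?thesis .
qed

lemma proj_line_normalized_rep:
  fixes x :: "'p::prime_card padic proj_line"
  obtains v where "x = abs_proj_line v" "padic_norm v = 1"
proof -
  obtain u where u: "x = abs_proj_line u" "u \<noteq> 0"
    using Quotient_abs_rep[OF Quotient_proj_line, of x]
      Quotient_rep_reflp[OF Quotient_proj_line, of x]
    by (metis proj_rel_def)
  obtain i where i: "padic_norm u = padic_abs (u $ i)" using padic_norm_eq_abs_nth ..
  hence norm: "padic_norm (inverse (u $ i) *s u) = 1"
    using u(2) by (simp add: padic_norm_scale divide_inverse padic_abs_pos_iff
        flip: padic_norm_pos_iff padic_abs_mult)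
  hence "inverse (u $ i) *s u \<noteq> 0" by (metis padic_norm_pos_iff zero_less_one)
  hence "x = abs_proj_line (inverse (u $ i) *s u)"
    using u by (simp add: abs_proj_line_eq_iff wedge_scale_right)
  thus ?thesis using norm by (rule that)
qed

lemma abs_proj_line_mem_PBad_iff:
  fixes v :: "'p::prime_card padic ^ 2"
  assumes "v \<noteq> 0"
  shows "abs_proj_line v \<in> PBad \<epsilon> \<longleftrightarrow>
    (\<forall>r. r \<noteq> 0 \<longrightarrow>
      \<epsilon> / real_of_int (height r) ^ 2 \<le> padic_abs (wedge (of_int_vec r) v) / padic_norm v)"
    (is "_ \<longleftrightarrow> ?bad")
proof -
  let ?approx = "\<lambda>a b :: int. \<epsilon> / max (real_of_int a ^ 2) (real_of_int b ^ 2)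
    \<le> padic_abs (of_int a * v $ 1 + of_int b * v $ 2) / padic_norm v"
  have "abs_proj_line v \<in> PBad \<epsilon> \<longleftrightarrow> (\<forall>a b. (a, b) \<noteq> (0, 0) \<longrightarrow> ?approx a b)"
    unfolding PBad_def padic_norm_2 mem_Collect_eq
    by (rule is_PBad.abs_eq) (use assms in \<open>auto simp: proj_rel_def intro!: exI[of _ 1]\<close>)
  also have "\<dots> \<longleftrightarrow> (\<forall>r :: int ^ 2. r \<noteq> 0 \<longrightarrow> ?approx (- (r $ 2)) (r $ 1))"
  proof (intro iffI allI impI)
    fix a b :: int
    assume "\<forall>r :: int ^ 2. r \<noteq> 0 \<longrightarrow> ?approx (- (r $ 2)) (r $ 1)" and "(a, b) \<noteq> (0, 0)"
    thus "?approx a b"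
      by (auto dest!: spec[of _ "vector [b, - a]"] simp: vec_eq_iff forall_2 add.commute)
  next
    fix r :: "int ^ 2"
    assume "\<forall>a b. (a, b) \<noteq> (0, 0) \<longrightarrow> ?approx a b" and "r \<noteq> 0"
    moreover from \<open>r \<noteq> 0\<close> have "(- (r $ 2), r $ 1) \<noteq> (0, 0)" by (auto simp: vec_eq_iff forall_2)
    ultimately show "?approx (- (r $ 2)) (r $ 1)" by blast
  qed
  also have "\<dots> \<longleftrightarrow> ?bad"
    by (simp add: height_power2 wedge_def max.commute algebra_simps)
  finally show ?thesis .
qed

lemma PBad_antimono:
  assumes "\<epsilon>' \<le> \<epsilon>"
  shows "PBad \<epsilon> \<subseteq> (PBad \<epsilon>' :: 'p::prime_card padic proj_line set)"
proof
  fix x :: "'p padic proj_line"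
  assume x: "x \<in> PBad \<epsilon>"
  obtain v where v: "x = abs_proj_line v" "padic_norm v = 1" by (rule proj_line_normalized_rep)
  hence "v \<noteq> 0" by (simp flip: padic_norm_pos_iff)
  moreover have "\<epsilon>' / real_of_int (height r) ^ 2 \<le> \<epsilon> / real_of_int (height r) ^ 2" for r
    using assms by (simp add: divide_right_mono)
  ultimately show "x \<in> PBad \<epsilon>'"
    using x unfolding v(1) abs_proj_line_mem_PBad_iff[OF \<open>v \<noteq> 0\<close>] by (meson order_trans)
qed

lemma finite_subset_PBad:
  assumes "finite X" and "\<And>x. x \<in> X \<Longrightarrow> \<exists>\<epsilon>>0. x \<in> PBad \<epsilon>"
  shows "\<exists>\<epsilon>>0. X \<subseteq> PBad \<epsilon>"
  using assms
proof (induction X rule: finite_induct)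
  case empty
  show ?case by (auto intro: exI[of _ 1])
next
  case (insert x X)
  then obtain \<epsilon> \<epsilon>' where "\<epsilon> > 0" "X \<subseteq> PBad \<epsilon>" "\<epsilon>' > 0" "x \<in> PBad \<epsilon>'" by (metis insertCI)
  moreover have "PBad \<epsilon> \<subseteq> PBad (min \<epsilon> \<epsilon>')" "PBad \<epsilon>' \<subseteq> PBad (min \<epsilon> \<epsilon>')"
    by (auto intro!: PBad_antimono)
  ultimately show ?case by (intro exI[of _ "min \<epsilon> \<epsilon>'"]) auto
qed

text \<open>Liouville's argument: if \<open>M v = c v\<close>, then \<open>wedge r v\<close> and \<open>wedge (M r) v\<close> have the same
  absolute value, so Cramer's rule for the basis \<open>r, M r\<close> bounds it from below by the absolute
  value of the nonzero integer \<open>wedge r (M r)\<close>.\<close>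

lemma hyperbolic_eigenvector_wedge_ge:
  fixes v :: "'p::prime_card padic ^ 2"
  assumes M: "hyperbolic M" and v: "is_eigenvector (of_int_mat M) v"
  shows "padic_abs (of_int (wedge r (M *v r)) :: 'p padic) * padic_norm v
    \<le> padic_abs (wedge (of_int_vec r) v)"
proof -
  obtain c where c: "of_int_mat M *v v = c *s v" and "v \<noteq> 0"
    using v by (auto simp: is_eigenvector_def)
  have det: "\<bar>det M\<bar> = 1" using M by (simp add: hyperbolic_def)
  hence "padic_abs (of_int (det M) :: 'p padic) = 1" by (rule padic_abs_of_int_unit)
  moreover have "padic_abs c = 1"
    using padic_norm_unimodular_mult[OF det, of v] \<open>v \<noteq> 0\<close>
    by (simp add: c padic_norm_scale flip: padic_norm_pos_iff)
  moreover let ?r = "of_int_vec r :: 'p padic ^ 2" and ?s = "of_int_vec (M *v r) :: 'p padic ^ 2"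
  have "c * wedge ?s v = of_int (det M) * wedge ?r v"
    using wedge_matrix_mult[of "of_int_mat M" ?r v]
    by (simp add: c wedge_scale_right det_of_int_mat of_int_vec_matrix_vector_mult)
  hence "padic_abs c * padic_abs (wedge ?s v)
      = padic_abs (of_int (det M) :: 'p padic) * padic_abs (wedge ?r v)"
    by (simp only: flip: padic_abs_mult)
  moreover have "padic_abs (wedge v ?s) = padic_abs (wedge ?s v)"
    using padic_abs_minus_commute by (simp add: wedge_def mult.commute)
  ultimately have eq: "padic_abs (wedge v ?s) = padic_abs (wedge ?r v)" by simp
  have "padic_abs (of_int (wedge r (M *v r)) :: 'p padic) * padic_norm v
      = padic_norm (wedge v ?s *s ?r + wedge ?r v *s ?s)"
    by (simp only: padic_norm_scale of_int_wedge flip: wedge_scale_cramer)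
  also have "\<dots> \<le> padic_abs (wedge ?r v)"
    by (intro padic_norm_add_le)
      (simp_all add: padic_norm_scale eq padic_norm_of_int_vec_le_1 padic_abs_nonneg mult_left_le)
  finally show ?thesis .
qed

lemma hyperbolic_eigenvector_imp_PBad:
  fixes v :: "'p::prime_card padic ^ 2"
  assumes M: "hyperbolic M" and v: "is_eigenvector (of_int_mat M) v"
  shows "\<exists>\<epsilon>>0. abs_proj_line v \<in> PBad \<epsilon>"
proof -
  have "v \<noteq> 0" using v by (simp add: is_eigenvector_def)
  hence norm: "padic_norm v > 0" by (simp add: padic_norm_pos_iff)
  define C where "C = 1 + (\<Sum>i\<in>UNIV. \<Sum>j\<in>UNIV. \<bar>M $ i $ j\<bar>)"
  have C: "C > 0" unfolding C_def by (simp add: add_pos_nonneg sum_nonneg)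
  have "1 / real_of_int C / real_of_int (height r) ^ 2
      \<le> padic_abs (wedge (of_int_vec r) v) / padic_norm v"
    if r: "r \<noteq> 0" for r
  proof -
    let ?q = "wedge r (M *v r)"
    have q: "?q \<noteq> 0" by (rule hyperbolic_wedge_nonzero[OF M r])
    have "\<bar>?q\<bar> \<le> C * (height r)\<^sup>2"
      using abs_wedge_matrix_mult_le[of r M] by (simp add: C_def distrib_right add_increasing)
    hence "real_of_int \<bar>?q\<bar> \<le> real_of_int (C * (height r)\<^sup>2)" by (simp only: of_int_le_iff)
    hence "1 / real_of_int (C * (height r)\<^sup>2) \<le> 1 / real_of_int \<bar>?q\<bar>"
      using q by (intro divide_left_mono) (auto intro: mult_pos_pos)
    also have "\<dots> \<le> padic_abs (of_int ?q :: 'p padic)" by (rule padic_abs_of_int_ge[OF q])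
    also have "\<dots> \<le> padic_abs (wedge (of_int_vec r) v) / padic_norm v"
      using hyperbolic_eigenvector_wedge_ge[OF M v, of r] norm by (simp add: pos_le_divide_eq)
    finally show ?thesis by simp
  qed
  hence "abs_proj_line v \<in> PBad (1 / real_of_int C)"
    by (simp add: abs_proj_line_mem_PBad_iff[OF \<open>v \<noteq> 0\<close>])
  thus ?thesis using C by (intro exI[of _ "1 / real_of_int C"]) simp
qed

lemma hyperbolic_orbit_in_PBad_imp_eigenvector:
  fixes v :: "'p::prime_card padic ^ 2"
  assumes M: "hyperbolic M" and v: "padic_norm v = 1" and \<epsilon>: "\<epsilon> > 0"
    and bad: "\<And>n. abs_proj_line (((*v) (of_int_mat M) ^^ n) v) \<in> PBad \<epsilon>"
  shows "is_eigenvector (of_int_mat M) v"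
proof (rule ccontr)
  let ?y = "\<lambda>n. ((*v) (of_int_mat M) ^^ n) v"
  assume "\<not> is_eigenvector (of_int_mat M) v"
  moreover have "v \<noteq> 0" using v by (simp flip: padic_norm_pos_iff)
  ultimately have "wedge v (of_int_mat M *v v) \<noteq> 0" by (simp add: is_eigenvector_iff_wedge)
  then obtain r where r: "r \<noteq> 0" and
    approach: "\<forall>e>0. \<exists>n. padic_abs (wedge (of_int_vec r) (?y n)) < e"
    using hyperbolic_orbit_approaches_rational[OF M v] by blast
  have "\<epsilon> / real_of_int (height r) ^ 2 > 0" using \<epsilon> r by (simp add: height_eq_0_iff)
  then obtain n where n: "padic_abs (wedge (of_int_vec r) (?y n)) < \<epsilon> / real_of_int (height r) ^ 2"
    using approach by blast
  have norm: "padic_norm (?y n) = 1"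
    using M v by (simp add: padic_norm_unimodular_orbit hyperbolic_def)
  hence "?y n \<noteq> 0" by (simp flip: padic_norm_pos_iff)
  thus False using bad[of n] r n norm by (auto simp: abs_proj_line_mem_PBad_iff not_le)
qed

section \<open>Orbits of the shift\<close>

fun cf_word_transpose :: "nat list \<Rightarrow> int ^ 2 ^ 2" where
  "cf_word_transpose [] = mat 1"
| "cf_word_transpose (a # u) = cf_word_transpose u ** vector [vector [0, 1], vector [1, int a]]"

lemma transpose_cf_word_matrix: "transpose (cf_word_matrix u) = of_int_mat (cf_word_transpose u)"
proof (induction u)
  case Nil
  show ?case by (simp add: cf_word_matrix_def of_int_mat_1)
next
  case (Cons a u)
  have "transpose (cf_matrix a)
      = (of_int_mat (vector [vector [0, 1], vector [1, int a]]) :: 'a ^ 2 ^ 2)"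
    by (simp add: cf_matrix_def vec_eq_iff forall_2 transpose_def)
  thus ?case using Cons
    by (simp add: cf_word_matrix_def matrix_transpose_mul of_int_mat_matrix_matrix_mult)
qed

lemma det_cf_word_transpose: "det (cf_word_transpose u) = (- 1) ^ length u"
  by (induction u) (simp_all add: det_mul, simp add: det_2)

lemma cf_word_transpose_nonneg:
  assumes "u \<noteq> []" and "set u \<subseteq> {1..}"
  defines "M \<equiv> cf_word_transpose u"
  shows "M $ 1 $ 1 \<ge> 0 \<and> M $ 1 $ 2 > 0 \<and> M $ 2 $ 1 > 0 \<and> M $ 2 $ 2 > 0"
  unfolding M_def using assms(1,2)
proof (induction u rule: list_nonempty_induct)
  case (cons a u)
  thus ?case by (auto simp: matrix_matrix_mult_def sum_2 add_nonneg_pos)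
qed (simp add: matrix_matrix_mult_def sum_2 mat_def)

lemma hyperbolic_cf_word_transpose:
  assumes "u \<noteq> []" and "set u \<subseteq> {1..}"
  shows "hyperbolic (cf_word_transpose u)"
proof -
  let ?M = "cf_word_transpose u"
  have pos: "?M $ 1 $ 1 \<ge> 0" "?M $ 1 $ 2 > 0" "?M $ 2 $ 1 > 0" "?M $ 2 $ 2 > 0"
    using cf_word_transpose_nonneg[OF assms] by auto
  have "(trace ?M)\<^sup>2 - 4 * det ?M = (?M $ 1 $ 1 - ?M $ 2 $ 2)\<^sup>2 + 4 * (?M $ 1 $ 2 * ?M $ 2 $ 1)"
    by (simp add: trace_def det_2 sum_2 power2_eq_square algebra_simps)
  also have "\<dots> > 0" using pos by (simp add: add_nonneg_pos)
  finally have "4 * det ?M < (trace ?M)\<^sup>2" by simp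
  moreover have "trace ?M \<noteq> 0" using pos by (simp add: trace_def sum_2)
  ultimately show ?thesis by (simp add: hyperbolic_def det_cf_word_transpose)
qed

lemma sdrop_in_streams: "w \<in> streams A \<Longrightarrow> sdrop n w \<in> streams A"
  by (simp add: streams_iff_snth sdrop_snth)

lemma hyperbolic_cf_word_transpose_stake:
  assumes "w \<in> streams {1..}" and "l > 0"
  shows "hyperbolic (cf_word_transpose (stake l w))"
  using assms
  by (intro hyperbolic_cf_word_transpose) (auto simp: in_set_conv_nth streams_iff_snth)

lemma fst_funpow_shift_pair: "fst ((shift_pair ^^ n) (w, x)) = sdrop n w"
  by (induction n) (simp_all add: shift_pair_def case_prod_beta)

lemma funpow_shift_pair:
  assumes "v \<noteq> 0"
  shows "(shift_pair ^^ n) (w, abs_proj_line v)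
    = (sdrop n w, abs_proj_line (of_int_mat (cf_word_transpose (stake n w)) *v v))"
  using assms
proof (induction n arbitrary: w v)
  case 0
  show ?case by (simp add: of_int_mat_1)
next
  case (Suc n)
  let ?u = "cf_matrix (shd w) *v v"
  have u: "?u \<noteq> 0" using Suc.prems by (auto simp: vec_eq_iff forall_2 cf_matrix_mult_vec)
  have "shift_pair (w, abs_proj_line v) = (stl w, abs_proj_line ?u)"
    unfolding shift_pair_def prod.case
    by (subst cf_act.abs_eq) (use Suc.prems in \<open>auto simp: proj_rel_def intro!: exI[of _ 1]\<close>)
  moreover have "?u = of_int_mat (vector [vector [0, 1], vector [1, int (shd w)]]) *v v"
    by (simp add: cf_matrix_def vec_eq_iff forall_2 matrix_vector_mult_def sum_2)
  ultimately show ?case using Suc.IH[OF u, of "stl w"]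
    by (simp add: funpow_Suc_right of_int_mat_matrix_matrix_mult matrix_vector_mul_assoc
        del: funpow.simps)
qed

lemma shift_pair_period_iff_eigenvector:
  fixes x :: "'p::prime_card padic proj_line"
  assumes l: "is_period w l" and w: "w \<in> streams {1..}"
  shows "(shift_pair ^^ l) (w, x) = (w, x) \<longleftrightarrow>
    (\<exists>v. is_eigenvector (transpose (cf_word_matrix (stake l w))) v \<and> x = abs_proj_line v)"
proof -
  let ?B = "of_int_mat (cf_word_transpose (stake l w)) :: 'p padic ^ 2 ^ 2"
  have "\<bar>det (cf_word_transpose (stake l w))\<bar> = 1" by (simp add: det_cf_word_transpose)
  note norm = padic_norm_unimodular_mult[OF this]
  have period: "(shift_pair ^^ l) (w, abs_proj_line v) = (w, abs_proj_line v) \<longleftrightarrow> is_eigenvector ?B v"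
    if "v \<noteq> 0" for v
  proof -
    have "?B *v v \<noteq> 0" using that by (simp add: norm flip: padic_norm_pos_iff)
    hence "(shift_pair ^^ l) (w, abs_proj_line v) = (w, abs_proj_line v) \<longleftrightarrow> wedge (?B *v v) v = 0"
      using l that by (simp add: funpow_shift_pair is_period_def abs_proj_line_eq_iff)
    also have "\<dots> \<longleftrightarrow> is_eigenvector ?B v"
      using that by (auto simp: is_eigenvector_iff_wedge wedge_def mult.commute)
    finally show ?thesis .
  qed
  obtain v where v: "x = abs_proj_line v" "padic_norm v = 1" by (rule proj_line_normalized_rep)
  hence "v \<noteq> 0" by (simp flip: padic_norm_pos_iff)
  moreover have "is_eigenvector ?B u \<Longrightarrow> u \<noteq> 0" for u by (simp add: is_eigenvector_def)
  ultimately show ?thesis unfolding transpose_cf_word_matrix using v(1) period by metis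
qed

lemma LMad_iff_PBad_orbit:
  assumes w: "w \<in> streams {1..N}"
  shows "(w, x) \<in> LMad \<longleftrightarrow> (\<exists>\<epsilon>>0. \<forall>n. snd ((shift_pair ^^ n) (w, x)) \<in> PBad \<epsilon>)"
proof
  assume "(w, x) \<in> LMad"
  thus "\<exists>\<epsilon>>0. \<forall>n. snd ((shift_pair ^^ n) (w, x)) \<in> PBad \<epsilon>"
    by (auto simp: LMad_def LMad_eps_def mem_Times_iff)
next
  assume "\<exists>\<epsilon>>0. \<forall>n. snd ((shift_pair ^^ n) (w, x)) \<in> PBad \<epsilon>"
  then obtain \<epsilon> where \<epsilon>: "\<epsilon> > 0" "\<And>n. snd ((shift_pair ^^ n) (w, x)) \<in> PBad \<epsilon>" by blast
  define \<delta> where "\<delta> = min \<epsilon> (1 / (real N + 1))"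
  have \<delta>: "\<delta> > 0" "\<delta> \<le> \<epsilon>" "real N + 1 \<le> 1 / \<delta>"
    using \<epsilon>(1) by (auto simp: \<delta>_def min_def field_simps)
  hence "N \<le> nat \<lfloor>1 / \<delta>\<rfloor> + 1" by linarith
  hence "{1..N} \<subseteq> {1..nat \<lfloor>1 / \<delta>\<rfloor> + 1}" by simp
  hence "fst ((shift_pair ^^ n) (w, x)) \<in> streams {1..nat \<lfloor>1 / \<delta>\<rfloor> + 1}" for n
    unfolding fst_funpow_shift_pair by (rule streams_mono[OF sdrop_in_streams[OF w]])
  moreover have "snd ((shift_pair ^^ n) (w, x)) \<in> PBad \<delta>" for n
    using \<epsilon>(2) PBad_antimono[OF \<delta>(2)] by blast
  moreover have "w \<in> streams {1..}" using w by (rule streams_mono) auto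
  ultimately show "(w, x) \<in> LMad" using \<delta>(1) by (auto simp: LMad_def LMad_eps_def mem_Times_iff)
qed

lemma shift_pair_periodic_imp_PBad:
  fixes z :: "nat stream \<times> 'p::prime_card padic proj_line"
  assumes w: "fst z \<in> streams {1..}" and l: "l > 0" and period: "(shift_pair ^^ l) z = z"
  shows "\<exists>\<epsilon>>0. snd z \<in> PBad \<epsilon>"
proof -
  obtain w x where z: "z = (w, x)" by fastforce
  have "sdrop l w = w" using fst_funpow_shift_pair[of l w x] period z by simp
  hence "is_period w l" using l by (simp add: is_period_def)
  then obtain v
    where "is_eigenvector (transpose (cf_word_matrix (stake l w))) v" "x = abs_proj_line v"
    using period w unfolding z by (auto simp: shift_pair_period_iff_eigenvector)
  thus ?thesis
    using hyperbolic_eigenvector_imp_PBad[OF hyperbolic_cf_word_transpose_stake[OF _ l]] w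
    by (simp add: z transpose_cf_word_matrix)
qed

lemma shift_pair_periodic_imp_LMad:
  fixes x :: "'p::prime_card padic proj_line"
  assumes w: "w \<in> streams {1..N}" and l: "l > 0" and period: "(shift_pair ^^ l) (w, x) = (w, x)"
  shows "(w, x) \<in> LMad"
proof -
  let ?orbit = "\<lambda>n. (shift_pair ^^ n) (w, x)"
  have "range ?orbit \<subseteq> ?orbit ` {..<l}"
  proof (rule image_subsetI)
    fix n
    have "?orbit n = ?orbit (n mod l)" by (rule funpow_mod_eq[OF period, symmetric])
    moreover have "n mod l \<in> {..<l}" using l by simp
    ultimately show "?orbit n \<in> ?orbit ` {..<l}" by (rule image_eqI)
  qed
  hence "finite (range ?orbit)" by (rule finite_subset) simp
  hence "finite (snd ` range ?orbit)" by (rule finite_imageI)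
  moreover have "\<exists>\<epsilon>>0. snd (?orbit n) \<in> PBad \<epsilon>" for n
  proof (rule shift_pair_periodic_imp_PBad[OF _ l])
    show "fst (?orbit n) \<in> streams {1..}"
      unfolding fst_funpow_shift_pair by (rule streams_mono[OF sdrop_in_streams[OF w]]) auto
    have "(shift_pair ^^ l) (?orbit n) = (shift_pair ^^ (n + l)) (w, x)"
      by (simp add: add.commute[of n] funpow_add)
    thus "(shift_pair ^^ l) (?orbit n) = ?orbit n" by (simp add: funpow_add period)
  qed
  ultimately have "\<exists>\<epsilon>>0. snd ` range ?orbit \<subseteq> PBad \<epsilon>" by (intro finite_subset_PBad) auto
  thus ?thesis unfolding LMad_iff_PBad_orbit[OF w] by blast
qed

lemma LMad_imp_shift_pair_periodic:
  fixes x :: "'p::prime_card padic proj_line"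
  assumes w: "w \<in> streams {1..N}" and l: "is_period w l" and x: "(w, x) \<in> LMad"
  shows "(shift_pair ^^ l) (w, x) = (w, x)"
proof -
  let ?M = "cf_word_transpose (stake l w)"
  have w1: "w \<in> streams {1..}" using w by (rule streams_mono) auto
  obtain v where v: "x = abs_proj_line v" "padic_norm v = 1" by (rule proj_line_normalized_rep)
  obtain \<epsilon> where \<epsilon>: "\<epsilon> > 0" "\<And>n. snd ((shift_pair ^^ n) (w, x)) \<in> PBad \<epsilon>"
    using x unfolding LMad_iff_PBad_orbit[OF w] by blast
  have M: "hyperbolic ?M"
    using hyperbolic_cf_word_transpose_stake[OF w1] l by (simp add: is_period_def)
  have "(shift_pair ^^ (l * n)) (w, x) = (w, abs_proj_line (((*v) (of_int_mat ?M) ^^ n) v))" for n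
  proof (induction n)
    case (Suc n)
    have "padic_norm (((*v) (of_int_mat ?M) ^^ n) v) = 1"
      using v(2) M by (simp add: padic_norm_unimodular_orbit hyperbolic_def)
    hence "((*v) (of_int_mat ?M) ^^ n) v \<noteq> 0" by (simp flip: padic_norm_pos_iff)
    thus ?case using Suc l by (simp add: funpow_add funpow_shift_pair is_period_def)
  qed (simp add: v(1))
  hence "is_eigenvector (of_int_mat ?M) v"
    using hyperbolic_orbit_in_PBad_imp_eigenvector[OF M v(2) \<epsilon>(1)] \<epsilon>(2) by (metis snd_conv)
  thus ?thesis
    unfolding shift_pair_period_iff_eigenvector[OF l w1] transpose_cf_word_matrix
    using v(1) by blast
qed

theorem theorem1:
  fixes N l :: nat and w :: "nat stream" and x :: "'p::prime_card padic proj_line"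
  assumes "w \<in> streams {1..N}"
    and "is_minimal_period w l"
  shows "(w, x) \<in> LMad \<longleftrightarrow>
    (\<exists>v. is_eigenvector (transpose (cf_word_matrix (stake l w))) v \<and> x = abs_proj_line v)"
proof -
  have l: "is_period w l" using assms(2) by (simp add: is_minimal_period_def)
  hence "(w, x) \<in> LMad \<longleftrightarrow> (shift_pair ^^ l) (w, x) = (w, x)"
    using LMad_imp_shift_pair_periodic shift_pair_periodic_imp_LMad assms(1)
    by (metis is_period_def)
  also have "\<dots> \<longleftrightarrow>
      (\<exists>v. is_eigenvector (transpose (cf_word_matrix (stake l w))) v \<and> x = abs_proj_line v)"
    by (intro shift_pair_period_iff_eigenvector[OF l] streams_mono[OF assms(1)]) auto
  finally show ?thesis .
qed

end
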